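(* Let $N\ge2$, let $\tau\ge1$ be an integer, and let $A_i\in\mathbb{R}^{n\times n}$, $B_i\in\mathbb{R}^{n\times m_i}$, $i=1,\ldots,N$. The following statements are equivalent: (a) There exist matrices $P_i\in\mathbb{S}_{\succ0}^n$ and matrix sequences $K_i:\{0,\ldots,\tau\}\to\mathbb{R}^{m_i\times n}$, $i=1,\ldots,N$, such that $$(A_i+B_iK_i(\tau))^\prime P_i(A_i+B_iK_i(\tau))-P_i\prec0\quad\text{and}\quad \Psi_i(\tau)^{\prime}P_i\Psi_i(\tau)-P_j\prec0$$ hold for all $i,j=1,\ldots,N$, $i\ne j$, where $$\Psi_i(\tau)=\prod_{k=0}^{\tau-1}(A_i+B_iK_i(k)):=(A_i+B_iK_i(\tau-1))\cdots(A_i+B_iK_i(1))(A_i+B_iK_i(0)).$$ (b) There exist matrix sequences $S_i:\{0,\ldots,\tau\}\to\mathbb{S}^n$, $S_i(\tau)\succ0$, $U_i:\{0,\ldots,\tau\}\to\mathbb{R}^{m_i\times n}$, $i=1,\ldots,N$, and a scalar $\varepsilon>0$ such that $$\begin{bmatrix}-S_i(\tau) & A_iS_i(\tau)+B_iU_i(\tau)\\ \star & -S_i(\tau)\end{bmatrix}\prec0,$$ $$\begin{bmatrix}-S_i(k+1) & A_iS_i(k)+B_iU_i(k)\\ \star & -S_i(k)\end{bmatrix}\preceq0,$$ $$S_j(\tau)-S_i(0)+\varepsilon I\preceq0$$ hold for all $i,j=1,\ldots,N$, $i\ne j$ and $k=0,\ldots,\tau-1$. Moreover, when one of the equivalent statements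 (a), (b) holds, the closed-loop switched system formed by $$x(t+1)=A_{\sigma(t)}x(t)+B_{\sigma(t)}u_{\sigma(t)}(t)$$ and the state-feedback law $$u_{\sigma(\phi_q)}(\phi_q+k)=\begin{cases}K_{\sigma(\phi_q)}(k)\,x(\phi_q+k), & k\in\{0,\ldots,\tau-1\},\\ K_{\sigma(\phi_q)}(\tau)\,x(\phi_q+k), & k\in\{\tau,\ldots,\tau_q-1\},\end{cases}$$ is asymptotically stable for all switching-time sequences $\{\phi_q\}_{q\in\mathbb{N}}$ satisfying $\tau_q\ge\tau$ for all $q$, with the controller gains $$K_i(k)=U_i(k)S_i(k)^{-1}.$$
   Context: $\mathbb{S}^n$ denotes the set of real symmetric $n\times n$ matrices and $\mathbb{S}^n_{\succ0}$ the set of positive definite ones. For symmetric $A,B$, $A\succ B$ (resp. $A\succeq B$) means $A-B$ is positive definite (resp. positive semidefinite); $\prec,\preceq$ are the reversed relations. $A^\prime$ is the transpose of $A$. In a symmetric block matrix, $\star$ stands for the block determined by symmetry. Switched system: the state is $x(t)\in\mathbb{R}^n$, $u_i(t)\in\mathbb{R}^{m_i}$ is the control input of mode $i$ (dimensions may differ between modes), and the switching signal is $\sigma:\mathbb{N}\to\{1,\ldots,N\}$, where $N$ is the number of subsystems. The switching instants $\{\phi_q\}_{q\in\mathbb{N}}$ are the instants at which $\sigma(t)$ changes value, with the convention $\phi_0=0$; $\sigma$ is constant on $\{\phi_q,\ldots,\phi_{q+1}-1\}$. The dwell-times are $\tau_q:=\phi_{q+1}-\phi_q$. When $\tau_q=\tau$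 the second branch of the control law is not used.
   Formalization: Statement (b) does not force S_i(k) to be invertible for 0<k<τ, so U_i(k)S_i(k)^{-1} may be undefined; stability with these gains is stated for solutions of (b) with all S_i(k) invertible, and such a solution is shown to exist whenever (b) holds. *)

theory Defs
  imports
    Complex_Main
    "HOL-Library.Extended_Nat"
    "Jordan_Normal_Form.Gauss_Jordan_Elimination"
begin

definition sym_mat :: "nat \<Rightarrow> real mat \<Rightarrow> bool" where
  "sym_mat n M \<longleftrightarrow> M \<in> carrier_mat n n \<and> transpose_mat M = M"

definition pos_def_mat :: "nat \<Rightarrow> real mat \<Rightarrow> bool" where
  "pos_def_mat n M \<longleftrightarrow> sym_mat n M \<and>
     (\<forall>v \<in> carrier_vec n. v \<noteq> 0\<^sub>v n \<longrightarrow> v \<bullet> (M *\<^sub>v v) > 0)"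

definition pos_semidef_mat :: "nat \<Rightarrow> real mat \<Rightarrow> bool" where
  "pos_semidef_mat n M \<longleftrightarrow> sym_mat n M \<and>
     (\<forall>v \<in> carrier_vec n. v \<bullet> (M *\<^sub>v v) \<ge> 0)"

definition mat_less :: "real mat \<Rightarrow> nat \<Rightarrow> real mat \<Rightarrow> bool"
    (\<open>(_ \<prec>\<^bsub>_\<^esub> _)\<close> [51, 0, 51] 50) where
  "X \<prec>\<^bsub>n\<^esub> Y \<longleftrightarrow> pos_def_mat n (Y - X)"

definition mat_le :: "real mat \<Rightarrow> nat \<Rightarrow> real mat \<Rightarrow> bool"
    (\<open>(_ \<preceq>\<^bsub>_\<^esub> _)\<close> [51, 0, 51] 50) where
  "X \<preceq>\<^bsub>n\<^esub> Y \<longleftrightarrow> pos_semidef_mat n (Y - X)"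

definition cl_mat ::
    "(nat \<Rightarrow> real mat) \<Rightarrow> (nat \<Rightarrow> real mat) \<Rightarrow> (nat \<Rightarrow> nat \<Rightarrow> real mat) \<Rightarrow> nat \<Rightarrow> nat \<Rightarrow> real mat" where
  "cl_mat A B K i k = A i + B i * K i k"

primrec Psi ::
    "nat \<Rightarrow> (nat \<Rightarrow> real mat) \<Rightarrow> (nat \<Rightarrow> real mat) \<Rightarrow> (nat \<Rightarrow> nat \<Rightarrow> real mat) \<Rightarrow> nat \<Rightarrow> nat \<Rightarrow> real mat" where
  "Psi n A B K i 0 = 1\<^sub>m n"
| "Psi n A B K i (Suc k) = cl_mat A B K i k * Psi n A B K i k"

definition gain_condition ::
    "nat \<Rightarrow> nat \<Rightarrow> nat \<Rightarrow> (nat \<Rightarrow> nat) \<Rightarrow> (nat \<Rightarrow> real mat) \<Rightarrow> (nat \<Rightarrow> real mat)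
     \<Rightarrow> (nat \<Rightarrow> real mat) \<Rightarrow> (nat \<Rightarrow> nat \<Rightarrow> real mat) \<Rightarrow> bool" where
  "gain_condition N \<tau> n m A B P K \<longleftrightarrow>
     (\<forall>i \<in> {1..N}. pos_def_mat n (P i)) \<and>
     (\<forall>i \<in> {1..N}. \<forall>k \<in> {0..\<tau>}. K i k \<in> carrier_mat (m i) n) \<and>
     (\<forall>i \<in> {1..N}. \<forall>j \<in> {1..N}. i \<noteq> j \<longrightarrow>
        transpose_mat (cl_mat A B K i \<tau>) * P i * cl_mat A B K i \<tau> - P i \<prec>\<^bsub>n\<^esub> 0\<^sub>m n n \<and>
        transpose_mat (Psi n A B K i \<tau>) * P i * Psi n A B K i \<tau> - P j \<prec>\<^bsub>n\<^esub> 0\<^sub>m n n)"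

definition sym_block :: "real mat \<Rightarrow> real mat \<Rightarrow> real mat \<Rightarrow> real mat" where
  "sym_block X Y Z = four_block_mat X Y (transpose_mat Y) Z"

definition lmi_condition ::
    "nat \<Rightarrow> nat \<Rightarrow> nat \<Rightarrow> (nat \<Rightarrow> nat) \<Rightarrow> (nat \<Rightarrow> real mat) \<Rightarrow> (nat \<Rightarrow> real mat)
     \<Rightarrow> (nat \<Rightarrow> nat \<Rightarrow> real mat) \<Rightarrow> (nat \<Rightarrow> nat \<Rightarrow> real mat) \<Rightarrow> real \<Rightarrow> bool" where
  "lmi_condition N \<tau> n m A B S U \<epsilon> \<longleftrightarrow>
     (\<forall>i \<in> {1..N}. \<forall>k \<in> {0..\<tau>}. sym_mat n (S i k)) \<and>
     (\<forall>i \<in> {1..N}. pos_def_mat n (S i \<tau>)) \<and>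
     (\<forall>i \<in> {1..N}. \<forall>k \<in> {0..\<tau>}. U i k \<in> carrier_mat (m i) n) \<and>
     \<epsilon> > 0 \<and>
     (\<forall>i \<in> {1..N}. \<forall>j \<in> {1..N}. \<forall>k \<in> {0..<\<tau>}. i \<noteq> j \<longrightarrow>
        sym_block (- S i \<tau>) (A i * S i \<tau> + B i * U i \<tau>) (- S i \<tau>) \<prec>\<^bsub>n + n\<^esub> 0\<^sub>m (n + n) (n + n) \<and>
        sym_block (- S i (Suc k)) (A i * S i k + B i * U i k) (- S i k) \<preceq>\<^bsub>n + n\<^esub> 0\<^sub>m (n + n) (n + n) \<and>
        S j \<tau> - S i 0 + \<epsilon> \<cdot>\<^sub>m 1\<^sub>m n \<preceq>\<^bsub>n\<^esub> 0\<^sub>m n n)"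

text \<open>
  The switching instants take values in the extended naturals so that signals with only finitely
  many switches are covered too: after the last switch the sequence is constantly \<open>\<infinity>\<close>, and the
  last dwell-time is \<open>\<infinity>\<close>.
\<close>

definition switching_signal :: "nat \<Rightarrow> (nat \<Rightarrow> nat) \<Rightarrow> (nat \<Rightarrow> enat) \<Rightarrow> bool" where
  "switching_signal N \<sigma> \<phi> \<longleftrightarrow>
     (\<forall>t. \<sigma> t \<in> {1..N}) \<and>
     \<phi> 0 = 0 \<and>
     (\<forall>q. if \<phi> q = \<infinity> then \<phi> (Suc q) = \<infinity> else \<phi> q < \<phi> (Suc q)) \<and>
     (\<forall>q s t. \<phi> q = enat s \<and> s \<le> t \<and> enat t < \<phi> (Suc q) \<longrightarrow> \<sigma> t = \<sigma> s) \<and>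
     (\<forall>q s s'. \<phi> q = enat s \<and> \<phi> (Suc q) = enat s' \<longrightarrow> \<sigma> s' \<noteq> \<sigma> s)"

text \<open>By the conventions of \<^typ>\<open>enat\<close>, the dwell-time is \<open>\<infinity>\<close> whenever \<open>\<phi> (Suc q) = \<infinity>\<close>.\<close>

definition dwell_time :: "(nat \<Rightarrow> enat) \<Rightarrow> nat \<Rightarrow> enat" where
  "dwell_time \<phi> q = \<phi> (Suc q) - \<phi> q"

definition state_feedback ::
    "nat \<Rightarrow> (nat \<Rightarrow> nat \<Rightarrow> real mat) \<Rightarrow> (nat \<Rightarrow> nat) \<Rightarrow> (nat \<Rightarrow> enat)
     \<Rightarrow> nat \<Rightarrow> (nat \<Rightarrow> real vec) \<Rightarrow> (nat \<Rightarrow> nat \<Rightarrow> real vec) \<Rightarrow> bool" where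
  "state_feedback \<tau> K \<sigma> \<phi> t0 x u \<longleftrightarrow>
     (\<forall>q s k. \<phi> q = enat s \<and> enat k < dwell_time \<phi> q \<and> t0 \<le> s + k \<longrightarrow>
        u (\<sigma> s) (s + k) =
          (if k < \<tau> then K (\<sigma> s) k *\<^sub>v x (s + k) else K (\<sigma> s) \<tau> *\<^sub>v x (s + k)))"

text \<open>State trajectories of the closed loop started at time \<open>t0\<close>; \<open>x\<close> is irrelevant before \<open>t0\<close>.\<close>

definition closed_loop ::
    "nat \<Rightarrow> nat \<Rightarrow> (nat \<Rightarrow> nat) \<Rightarrow> (nat \<Rightarrow> real mat) \<Rightarrow> (nat \<Rightarrow> real mat)
     \<Rightarrow> (nat \<Rightarrow> nat \<Rightarrow> real mat) \<Rightarrow> (nat \<Rightarrow> nat) \<Rightarrow> (nat \<Rightarrow> enat)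
     \<Rightarrow> nat \<Rightarrow> (nat \<Rightarrow> real vec) \<Rightarrow> bool" where
  "closed_loop \<tau> n m A B K \<sigma> \<phi> t0 x \<longleftrightarrow>
     (\<forall>t \<ge> t0. x t \<in> carrier_vec n) \<and>
     (\<exists>u. (\<forall>t \<ge> t0. u (\<sigma> t) t \<in> carrier_vec (m (\<sigma> t))) \<and>
          (\<forall>t \<ge> t0. x (Suc t) = A (\<sigma> t) *\<^sub>v x t + B (\<sigma> t) *\<^sub>v u (\<sigma> t) t) \<and>
          state_feedback \<tau> K \<sigma> \<phi> t0 x u)"

definition vec_nrm :: "real vec \<Rightarrow> real" where
  "vec_nrm v = sqrt (v \<bullet> v)"

text \<open>
  Asymptotic stability of the origin of a time-varying system, in the usual sense of Lyapunov
  stability plus convergence of all trajectories, for every initial time. \<open>traj t0 x\<close> says that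
  \<open>x\<close> is a trajectory started at time \<open>t0\<close>. Since the closed loop is linear in the state, local
  and global attractivity coincide.
\<close>

definition asymptotically_stable :: "(nat \<Rightarrow> (nat \<Rightarrow> real vec) \<Rightarrow> bool) \<Rightarrow> bool" where
  "asymptotically_stable traj \<longleftrightarrow>
     (\<forall>t0. (\<forall>e > 0. \<exists>d > 0. \<forall>x. traj t0 x \<and> vec_nrm (x t0) < d \<longrightarrow> (\<forall>t \<ge> t0. vec_nrm (x t) < e)) \<and>
           (\<forall>x. traj t0 x \<longrightarrow> (\<lambda>t. vec_nrm (x t)) \<longlonglongrightarrow> 0))"

definition stabilizing ::
    "nat \<Rightarrow> nat \<Rightarrow> nat \<Rightarrow> (nat \<Rightarrow> nat) \<Rightarrow> (nat \<Rightarrow> real mat) \<Rightarrow> (nat \<Rightarrow> real mat)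
     \<Rightarrow> (nat \<Rightarrow> nat \<Rightarrow> real mat) \<Rightarrow> bool" where
  "stabilizing N \<tau> n m A B K \<longleftrightarrow>
     (\<forall>\<sigma> \<phi>. switching_signal N \<sigma> \<phi> \<and> (\<forall>q. dwell_time \<phi> q \<ge> enat \<tau>) \<longrightarrow>
        asymptotically_stable (closed_loop \<tau> n m A B K \<sigma> \<phi>))"

text \<open>
  Only \<open>S i 0\<close> and \<open>S i \<tau>\<close> are forced to be invertible by \<^const>\<open>lmi_condition\<close>; for
  \<open>0 < k < \<tau>\<close> the matrix \<open>S i k\<close> may be singular, and then the gain formula
  \<open>U i k * (S i k)\<^sup>-\<^sup>1\<close> is meaningless.
\<close>

definition all_invertible :: "nat \<Rightarrow> nat \<Rightarrow> (nat \<Rightarrow> nat \<Rightarrow> real mat) \<Rightarrow> bool" where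
  "all_invertible N \<tau> S \<longleftrightarrow> (\<forall>i \<in> {1..N}. \<forall>k \<in> {0..\<tau>}. invertible_mat (S i k))"

definition lmi_gain ::
    "(nat \<Rightarrow> nat \<Rightarrow> real mat) \<Rightarrow> (nat \<Rightarrow> nat \<Rightarrow> real mat) \<Rightarrow> nat \<Rightarrow> nat \<Rightarrow> real mat" where
  "lmi_gain S U i k = U i k * the (mat_inverse (S i k))"

end

theory Submission
  imports Defs "Jordan_Normal_Form.Determinant"
begin

text \<open>
  Everything is read through quadratic forms, writing \<open>qform M v\<close> for \<open>v \<bullet> M v\<close>, and through one
  intermediate object: a \<open>lyapunov_certificate\<close>, a family of positive definite matrices \<open>Q i k\<close>
  weighing the state of mode \<open>i\<close> when \<open>k\<close> steps have passed since the last switch, with \<open>k\<close> frozen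
  at \<open>\<tau>\<close>. Its form decreases by at least \<open>\<eta> |x|\<^sup>2\<close> at every step of the closed loop, and on entering
  a mode \<open>i\<close> it starts with a weight \<open>Q i 0\<close> below the final weight \<open>Q j \<tau>\<close> of every other mode.

  \<^emph>\<open>Gains give a certificate.\<close> Put \<open>Q i \<tau> = P i\<close> and go backwards by
  \<open>Q i k = F' Q i (k + 1) F + \<rho> I\<close>, where \<open>F\<close> is the closed-loop matrix at step \<open>k\<close>. For small
  \<open>\<rho>\<close>, \<open>Q i 0\<close> exceeds \<open>\<Psi>' P i \<Psi>\<close> by as little as desired, so the strict inequality
  \<open>\<Psi>' P i \<Psi> \<prec> P j\<close> leaves room for it (\<open>backward_lyapunov_sequence\<close>, \<open>gain_imp_certificate\<close>).

  \<^emph>\<open>A certificate gives the block inequalities.\<close> Take \<open>S i k\<close> to be the inverse of \<open>Q i k\<close> and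
  \<open>U i k = K i k S i k\<close>. Completing the square shows that each block inequality says the same as a
  one-step decrease of the inverse weights (\<open>schur_le_iff\<close>, \<open>schur_less_iff\<close>), and inversion
  reverses the order between the entry and final weights (\<open>qform_inverse_antitone\<close>).

  \<^emph>\<open>Block inequalities give gains.\<close> If all \<open>S i k\<close> are invertible the same equivalences are read
  backwards and telescope along one dwell period (\<open>invertible_lmi_imp_gain\<close>). Intermediate
  \<open>S i k\<close> may be singular; adding \<open>\<eta> c\<^sup>k I\<close> for \<open>k < \<tau>\<close>, with \<open>c\<close> larger than all squared norms of
  the \<open>A i\<close>, and scaling \<open>S i \<tau>\<close> and \<open>U i \<tau>\<close> up slightly preserves the block inequalities, because
  the term \<open>\<eta> c\<^sup>k A i\<close> thereby added off the diagonal is dominated by the two diagonal ones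
  (\<open>lmi_imp_invertible_lmi\<close>).

  \<^emph>\<open>A certificate gives stability.\<close> Along a trajectory the certificate is a single time-varying
  Lyapunov function that decreases at every instant, across switches as well; uniform upper and
  lower bounds over the finitely many weights give stability, and convergence holds because its
  decrements dominate \<open>\<eta> |x t|\<^sup>2\<close> and tend to zero (\<open>certificate_imp_stabilizing\<close>).
\<close>

section \<open>Quadratic forms of real matrices\<close>

definition qform :: "real mat \<Rightarrow> real vec \<Rightarrow> real" where
  "qform M v = v \<bullet> (M *\<^sub>v v)"

lemma sym_mat_carrier: "sym_mat n M \<Longrightarrow> M \<in> carrier_mat n n"
  by (simp add: sym_mat_def)

lemma pos_def_sym: "pos_def_mat n M \<Longrightarrow> sym_mat n M"
  by (simp add: pos_def_mat_def)

lemma pos_def_carrier: "pos_def_mat n M \<Longrightarrow> M \<in> carrier_mat n n"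
  by (simp add: pos_def_mat_def sym_mat_def)

lemma pos_def_qform:
  "pos_def_mat n M \<longleftrightarrow> sym_mat n M \<and> (\<forall>v \<in> carrier_vec n. v \<noteq> 0\<^sub>v n \<longrightarrow> 0 < qform M v)"
  by (simp add: pos_def_mat_def qform_def)

lemma pos_semidef_qform:
  "pos_semidef_mat n M \<longleftrightarrow> sym_mat n M \<and> (\<forall>v \<in> carrier_vec n. 0 \<le> qform M v)"
  by (simp add: pos_semidef_mat_def qform_def)

lemma mult_mat_zero_vec: "(M :: real mat) \<in> carrier_mat n k \<Longrightarrow> M *\<^sub>v 0\<^sub>v k = 0\<^sub>v n"
  by (intro eq_vecI) auto

lemma scalar_prod_self_nonneg: "0 \<le> v \<bullet> (v :: real vec)"
  by (auto simp: scalar_prod_def intro: sum_nonneg)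

lemma scalar_prod_self_pos:
  fixes v :: "real vec"
  assumes "v \<in> carrier_vec n" and "v \<noteq> 0\<^sub>v n"
  shows "0 < v \<bullet> v"
proof -
  obtain i where i: "i < n" "v $ i \<noteq> 0"
    using assms by (metis carrier_vecD eq_vecI index_zero_vec)
  have "0 < (\<Sum>i = 0..<n. v $ i * v $ i)"
    by (rule sum_pos2[of _ i]) (use i in \<open>auto simp: zero_less_mult_iff\<close>)
  then show ?thesis using assms(1) by (simp add: scalar_prod_def)
qed

lemma sym_mat_swap:
  assumes "sym_mat n M" and "v \<in> carrier_vec n" and "w \<in> carrier_vec n"
  shows "v \<bullet> (M *\<^sub>v w) = w \<bullet> (M *\<^sub>v v)"
proof -
  have M: "M \<in> carrier_mat n n" "transpose_mat M = M"
    using assms(1) by (auto simp: sym_mat_def)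
  have "v \<bullet> (M *\<^sub>v w) = (M *\<^sub>v v) \<bullet> w"
    using transpose_vec_mult_scalar[OF M(1) assms(3,2)] M(2) by simp
  also have "\<dots> = w \<bullet> (M *\<^sub>v v)"
    by (rule comm_scalar_prod[of _ n]) (use M assms in auto)
  finally show ?thesis .
qed

lemma qform_mat:
  assumes "v \<in> carrier_vec n"
  shows "X \<in> carrier_mat n n \<Longrightarrow> Y \<in> carrier_mat n n \<Longrightarrow> qform (X + Y) v = qform X v + qform Y v"
    and "X \<in> carrier_mat n n \<Longrightarrow> Y \<in> carrier_mat n n \<Longrightarrow> qform (X - Y) v = qform X v - qform Y v"
    and "X \<in> carrier_mat n n \<Longrightarrow> qform (c \<cdot>\<^sub>m X) v = c * qform X v"
    and "X \<in> carrier_mat n n \<Longrightarrow> qform (- X) v = - qform X v"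
    and "qform (1\<^sub>m n) v = v \<bullet> v"
    and "qform (0\<^sub>m n n) v = 0"
proof -
  assume X: "X \<in> carrier_mat n n"
  show "qform (c \<cdot>\<^sub>m X) v = c * qform X v"
    unfolding qform_def using X assms by (auto simp: scalar_prod_def sum_distrib_left ac_simps intro!: sum.cong)
  show "qform (- X) v = - qform X v"
    unfolding qform_def using X assms by simp
  assume Y: "Y \<in> carrier_mat n n"
  show "qform (X + Y) v = qform X v + qform Y v"
    unfolding qform_def using X Y assms
    by (simp add: add_mult_distrib_mat_vec[of _ n n] scalar_prod_add_distrib[of _ n])
  show "qform (X - Y) v = qform X v - qform Y v"
    unfolding qform_def using X Y assms
    by (simp add: minus_mult_distrib_mat_vec[of _ n n] scalar_prod_minus_distrib[of _ n])
next
  show "qform (1\<^sub>m n) v = v \<bullet> v" "qform (0\<^sub>m n n) v = 0"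
    unfolding qform_def using assms by (auto simp: scalar_prod_def)
qed

lemma qform_add_vec:
  assumes M: "sym_mat n M" and v: "v \<in> carrier_vec n" and w: "w \<in> carrier_vec n"
  shows "qform M (v + w) = qform M v + 2 * (v \<bullet> (M *\<^sub>v w)) + qform M w"
  using sym_mat_swap[OF assms] sym_mat_carrier[OF M] v w
  by (simp add: qform_def mult_add_distrib_mat_vec[of _ n n] scalar_prod_add_distrib[of _ n]
      add_scalar_prod_distrib[of _ n])

lemma qform_diff_vec:
  assumes M: "sym_mat n M" and v: "v \<in> carrier_vec n" and w: "w \<in> carrier_vec n"
  shows "qform M (v - w) = qform M v - 2 * (v \<bullet> (M *\<^sub>v w)) + qform M w"
  using sym_mat_swap[OF assms] sym_mat_carrier[OF M] v w
  by (simp add: qform_def mult_minus_distrib_mat_vec[of _ n n] scalar_prod_minus_distrib[of _ n]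
      minus_scalar_prod_distrib[of _ n])

lemma qform_smult_vec:
  assumes "M \<in> carrier_mat n n" and "v \<in> carrier_vec n"
  shows "qform M (t \<cdot>\<^sub>v v) = t\<^sup>2 * qform M v"
  using assms by (simp add: qform_def mult_mat_vec[of _ n n] power2_eq_square)

lemma qform_congruence:
  assumes F: "F \<in> carrier_mat n n" and P: "P \<in> carrier_mat n n" and v: "v \<in> carrier_vec n"
  shows "qform (transpose_mat F * P * F) v = qform P (F *\<^sub>v v)"
proof -
  have "v \<bullet> (transpose_mat F * P * F *\<^sub>v v) = v \<bullet> (transpose_mat F *\<^sub>v (P *\<^sub>v (F *\<^sub>v v)))"
    using assms by (simp add: assoc_mult_mat_vec[of _ n n _ n])
  also have "\<dots> = (transpose_mat (transpose_mat F) *\<^sub>v v) \<bullet> (P *\<^sub>v (F *\<^sub>v v))"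
    by (rule transpose_vec_mult_scalar[symmetric, of _ n n]) (use assms in auto)
  finally show ?thesis by (simp add: qform_def)
qed

lemma sym_mat_intros:
  shows "sym_mat n X \<Longrightarrow> sym_mat n Y \<Longrightarrow> sym_mat n (X + Y)"
    and "sym_mat n X \<Longrightarrow> sym_mat n Y \<Longrightarrow> sym_mat n (X - Y)"
    and "sym_mat n X \<Longrightarrow> sym_mat n (c \<cdot>\<^sub>m X)"
    and "sym_mat n X \<Longrightarrow> sym_mat n (- X)"
    and "sym_mat n (1\<^sub>m n)"
    and "sym_mat n (0\<^sub>m n n)"
    and "sym_mat n X \<Longrightarrow> F \<in> carrier_mat n n \<Longrightarrow> sym_mat n (transpose_mat F * X * F)"
proof -
  show "sym_mat n X \<Longrightarrow> sym_mat n (c \<cdot>\<^sub>m X)"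
  proof -
    have "transpose_mat (c \<cdot>\<^sub>m X) = c \<cdot>\<^sub>m transpose_mat X" by (intro eq_matI) auto
    then show "sym_mat n X \<Longrightarrow> sym_mat n (c \<cdot>\<^sub>m X)" by (simp add: sym_mat_def)
  qed
  show "sym_mat n (transpose_mat F * X * F)" if "sym_mat n X" "F \<in> carrier_mat n n"
  proof -
    have C: "X \<in> carrier_mat n n" "transpose_mat F \<in> carrier_mat n n" "transpose_mat X = X"
      using that by (auto simp: sym_mat_def)
    have "transpose_mat (transpose_mat F * X * F) = transpose_mat F * (X * F)"
      using C that(2) transpose_mult[of "transpose_mat F * X" n n F n] transpose_mult[OF C(2,1)]
      by simp
    then show ?thesis
      using C that(2) assoc_mult_mat[OF C(2,1) that(2)] by (simp add: sym_mat_def)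
  qed
qed (auto simp: sym_mat_def transpose_add[of _ n n] transpose_minus[of _ n n] transpose_uminus)

text \<open>
  The form of \<open>v + t w\<close> is a nonnegative polynomial in \<open>t\<close> of degree at most two, so its
  discriminant is not positive.
\<close>

lemma qform_cauchy_schwarz:
  assumes M: "pos_semidef_mat n M" and v: "v \<in> carrier_vec n" and w: "w \<in> carrier_vec n"
  shows "(v \<bullet> (M *\<^sub>v w))\<^sup>2 \<le> qform M v * qform M w"
proof -
  let ?b = "v \<bullet> (M *\<^sub>v w)"
  have sym: "sym_mat n M" and nonneg: "\<And>u. u \<in> carrier_vec n \<Longrightarrow> 0 \<le> qform M u"
    using M by (auto simp: pos_semidef_qform)
  note Mc = sym_mat_carrier[OF sym]
  have quad: "0 \<le> qform M v + 2 * t * ?b + t\<^sup>2 * qform M w" for t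
    using nonneg[of "v + t \<cdot>\<^sub>v w"] v w Mc
    by (simp add: qform_add_vec[OF sym] qform_smult_vec mult_mat_vec[of _ n n]
        scalar_prod_smult_distrib[of _ n])
  show ?thesis
  proof (cases "qform M w = 0")
    case True
    have "?b = 0"
    proof (rule ccontr)
      assume "?b \<noteq> 0"
      then have "0 \<le> qform M v + - (qform M v + 1)"
        \<comment> \<open>a nonconstant affine function of \<open>t\<close> takes the value \<open>-1\<close>\<close>
        using quad[of "- (qform M v + 1) / (2 * ?b)"] True by (simp add: field_simps)
      then show False by simp
    qed
    then show ?thesis by (simp add: True)
  next
    case False
    then have pos: "0 < qform M w" using nonneg[OF w] by simp
    have "0 \<le> qform M v - ?b\<^sup>2 / qform M w"
      \<comment> \<open>the minimizer of the polynomial\<close>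
      using quad[of "- ?b / qform M w"] False by (simp add: power2_eq_square field_simps)
    then show ?thesis using pos by (simp add: field_simps)
  qed
qed

lemma pos_def_pos_semidef: "pos_def_mat n M \<Longrightarrow> pos_semidef_mat n M"
  unfolding pos_def_qform pos_semidef_qform
proof safe
  fix v :: "real vec"
  assume "\<forall>v\<in>carrier_vec n. v \<noteq> 0\<^sub>v n \<longrightarrow> 0 < qform M v" "v \<in> carrier_vec n" "sym_mat n M"
  then show "0 \<le> qform M v"
    by (cases "v = 0\<^sub>v n") (auto simp: qform_def sym_mat_def less_imp_le)
qed

lemma qform_nonneg: "pos_def_mat n M \<Longrightarrow> v \<in> carrier_vec n \<Longrightarrow> 0 \<le> qform M v"
  using pos_def_pos_semidef by (auto simp: pos_semidef_qform)

lemma invertible_mat_inverse: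
  fixes M :: "real mat"
  assumes M: "M \<in> carrier_mat n n" and inv: "invertible_mat M"
  defines "R \<equiv> the (mat_inverse M)"
  shows "R \<in> carrier_mat n n" and "M * R = 1\<^sub>m n" and "R * M = 1\<^sub>m n"
proof -
  obtain B where B: "M * B = 1\<^sub>m n" "B * M = 1\<^sub>m (dim_row B)"
    using inv M by (auto simp: invertible_mat_def inverts_mat_def)
  have "dim_row B = n" "dim_col B = n"
    using B M by (metis carrier_matD(2) index_mult_mat(3) index_one_mat(3))+
  then have "M \<in> Units (ring_mat TYPE(real) n ())"
    using B M by (auto simp: Units_def ring_mat_def intro!: bexI[of _ B])
  then obtain C where C: "mat_inverse M = Some C"
    using mat_inverse(1)[OF M, of "()"] by blast
  show "R \<in> carrier_mat n n" "M * R = 1\<^sub>m n" "R * M = 1\<^sub>m n"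
    using mat_inverse(2)[OF M C] by (auto simp: R_def C)
qed

lemma pos_def_invertible:
  assumes "pos_def_mat n M"
  shows "invertible_mat M"
proof -
  note M = pos_def_carrier[OF assms]
  have "det M \<noteq> 0"
  proof
    assume "det M = 0"
    then obtain v where "v \<in> carrier_vec n" "v \<noteq> 0\<^sub>v n" "M *\<^sub>v v = 0\<^sub>v n"
      using det_0_iff_vec_prod_zero[OF M] by auto
    then show False using assms by (auto simp: pos_def_mat_def)
  qed
  then have "M \<in> Units (ring_mat TYPE(real) n ())"
    by (rule det_non_zero_imp_unit[OF M])
  then show ?thesis
    using M by (auto simp: Units_def ring_mat_def invertible_mat_def inverts_mat_def)
qed

text \<open>
  By Cauchy-Schwarz a vector with vanishing form lies in the kernel.
\<close>

lemma pos_semidef_invertible_pos_def: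
  assumes M: "pos_semidef_mat n M" and inv: "invertible_mat M"
  shows "pos_def_mat n M"
  unfolding pos_def_qform
proof (intro conjI ballI impI)
  show sym: "sym_mat n M" using M by (simp add: pos_semidef_qform)
  note Mc = sym_mat_carrier[OF sym]
  fix w :: "real vec"
  assume w: "w \<in> carrier_vec n" and "w \<noteq> 0\<^sub>v n"
  have "qform M w \<noteq> 0"
  proof
    assume "qform M w = 0"
    then have "(M *\<^sub>v w) \<bullet> (M *\<^sub>v w) = 0"
      using qform_cauchy_schwarz[OF M _ w, of "M *\<^sub>v w"] Mc w by simp
    then have "M *\<^sub>v w = 0\<^sub>v n"
      using scalar_prod_self_pos[of "M *\<^sub>v w" n] Mc w by fastforce
    then have "the (mat_inverse M) * M *\<^sub>v w = 0\<^sub>v n"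
      using invertible_mat_inverse(1)[OF Mc inv] Mc w by (simp add: mult_mat_zero_vec)
    then show False
      using invertible_mat_inverse(3)[OF Mc inv] w \<open>w \<noteq> 0\<^sub>v n\<close> by simp
  qed
  then show "0 < qform M w" using M w by (simp add: pos_semidef_qform order_less_le)
qed

lemma pos_def_inverse:
  assumes M: "pos_def_mat n M"
  defines "R \<equiv> the (mat_inverse M)"
  shows "pos_def_mat n R"
    and "v \<in> carrier_vec n \<Longrightarrow> M *\<^sub>v (R *\<^sub>v v) = v"
    and "v \<in> carrier_vec n \<Longrightarrow> R *\<^sub>v (M *\<^sub>v v) = v"
    and "v \<in> carrier_vec n \<Longrightarrow> qform M (R *\<^sub>v v) = qform R v"
proof -
  note Mc = pos_def_carrier[OF M]
  note R = invertible_mat_inverse[OF Mc pos_def_invertible[OF M], folded R_def]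
  show MR: "M *\<^sub>v (R *\<^sub>v v) = v" if "v \<in> carrier_vec n" for v
    using that R Mc by (simp flip: assoc_mult_mat_vec[of _ n n])
  show "R *\<^sub>v (M *\<^sub>v v) = v" if "v \<in> carrier_vec n" for v
    using that R Mc by (simp flip: assoc_mult_mat_vec[of _ n n])
  have eq: "qform M (R *\<^sub>v v) = qform R v" if v: "v \<in> carrier_vec n" for v
    using MR[OF v] v R by (simp add: qform_def comm_scalar_prod[of _ n])
  then show "v \<in> carrier_vec n \<Longrightarrow> qform M (R *\<^sub>v v) = qform R v" .
  have "transpose_mat R = transpose_mat R * (M * R)" using R by simp
  also have "\<dots> = transpose_mat (M * R) * R"
    using R(1) Mc M by (simp add: transpose_mult[of M n n R n] pos_def_mat_def sym_mat_def
        assoc_mult_mat[of "transpose_mat R" n n M n R n])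
  finally have "sym_mat n R" using R by (simp add: sym_mat_def)
  moreover have "0 < qform R v" if v: "v \<in> carrier_vec n" "v \<noteq> 0\<^sub>v n" for v
  proof -
    have "R *\<^sub>v v \<noteq> 0\<^sub>v n" using MR[OF v(1)] v Mc by (metis mult_mat_zero_vec)
    then show ?thesis using M v R eq[OF v(1)] by (metis mult_mat_vec_carrier pos_def_qform)
  qed
  ultimately show "pos_def_mat n R" by (simp add: pos_def_qform)
qed

text \<open>
  Bounds are stated for all large constants, and in \<open>pos_def_coercive\<close> for all small positive
  ones, so that finitely many of them combine into a uniform bound.
\<close>

lemma qform_bounded:
  assumes M: "M \<in> carrier_mat n n"
  shows "\<forall>\<^sub>F C in at_top. \<forall>v \<in> carrier_vec n. qform M v \<le> C * (v \<bullet> v)"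
proof -
  \<comment> \<open>each \<open>v $ i * v $ j\<close> is at most \<open>v \<bullet> v\<close>, so the sum of the absolute entries bounds the form\<close>
  define C0 where "C0 = (\<Sum>i = 0..<n. \<Sum>j = 0..<n. \<bar>M $$ (i, j)\<bar>)"
  have "qform M v \<le> C0 * (v \<bullet> v)" if v: "v \<in> carrier_vec n" for v
  proof -
    have sq: "(v $ i)\<^sup>2 \<le> v \<bullet> v" if "i < n" for i
    proof -
      have "v $ i * v $ i \<le> (\<Sum>i = 0..<n. v $ i * v $ i)"
        by (rule member_le_sum) (use that in auto)
      then show ?thesis using v by (simp add: scalar_prod_def power2_eq_square)
    qed
    have *: "\<bar>v $ i * v $ j\<bar> \<le> v \<bullet> v" if "i < n" "j < n" for i j
    proof -
      have "0 \<le> (\<bar>v $ i\<bar> - \<bar>v $ j\<bar>)\<^sup>2" by simp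
      then have "2 * \<bar>v $ i * v $ j\<bar> \<le> (v $ i)\<^sup>2 + (v $ j)\<^sup>2"
        by (simp add: power2_diff abs_mult)
      then show ?thesis using sq[OF that(1)] sq[OF that(2)] by simp
    qed
    have "M $$ (i, j) * (v $ i * v $ j) \<le> \<bar>M $$ (i, j)\<bar> * (v \<bullet> v)" if "i < n" "j < n" for i j
    proof -
      have "M $$ (i, j) * (v $ i * v $ j) \<le> \<bar>M $$ (i, j)\<bar> * \<bar>v $ i * v $ j\<bar>"
        by (metis abs_ge_self abs_mult)
      also have "\<dots> \<le> \<bar>M $$ (i, j)\<bar> * (v \<bullet> v)"
        by (rule mult_left_mono[OF *[OF that]]) simp
      finally show ?thesis .
    qed
    then have "(\<Sum>i = 0..<n. \<Sum>j = 0..<n. M $$ (i, j) * (v $ i * v $ j)) \<le> C0 * (v \<bullet> v)"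
      unfolding C0_def sum_distrib_right by (intro sum_mono) auto
    moreover have "qform M v = (\<Sum>i = 0..<n. \<Sum>j = 0..<n. M $$ (i, j) * (v $ i * v $ j))"
      using v M by (auto simp: qform_def scalar_prod_def sum_distrib_left ac_simps intro!: sum.cong)
    ultimately show ?thesis by simp
  qed
  then show ?thesis
    by (intro eventually_at_top_linorderI[of C0])
      (meson mult_right_mono order_trans scalar_prod_self_nonneg)
qed

text \<open>
  With \<open>R\<close> the inverse of \<open>M\<close>, Cauchy-Schwarz for the form of \<open>M\<close> applied to \<open>v\<close> and \<open>R v\<close> gives
  \<open>|v|\<^sup>4 \<le> qform M v * qform R v\<close>, so an upper bound for \<open>R\<close> is a lower bound for \<open>M\<close>.
\<close>

lemma pos_def_coercive:
  assumes M: "pos_def_mat n M"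
  shows "\<forall>\<^sub>F c in at_right 0. \<forall>v \<in> carrier_vec n. c * (v \<bullet> v) \<le> qform M v"
proof -
  let ?R = "the (mat_inverse M)"
  note Mc = pos_def_carrier[OF M]
  note R = pos_def_inverse[OF M]
  note Rc = pos_def_carrier[OF R(1)]
  obtain C where C: "C > 0" "\<And>v. v \<in> carrier_vec n \<Longrightarrow> qform ?R v \<le> C * (v \<bullet> v)"
    using eventually_happens[OF eventually_conj[OF eventually_gt_at_top[of 0] qform_bounded[OF Rc]]]
    by auto
  have "(1 / C) * (v \<bullet> v) \<le> qform M v" if v: "v \<in> carrier_vec n" for v
  proof (cases "v = 0\<^sub>v n")
    case True
    then show ?thesis using Mc by (simp add: qform_def)
  next
    case False
    have pos: "0 < v \<bullet> v" by (rule scalar_prod_self_pos[OF v False])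
    have "(v \<bullet> v)\<^sup>2 \<le> qform M v * qform ?R v"
      using qform_cauchy_schwarz[OF pos_def_pos_semidef[OF M] v, of "?R *\<^sub>v v"] R v Rc by simp
    also have "\<dots> \<le> qform M v * (C * (v \<bullet> v))"
      by (rule mult_left_mono[OF C(2)[OF v] qform_nonneg[OF M v]])
    finally have "v \<bullet> v \<le> qform M v * C"
      using pos by (simp add: power2_eq_square)
    then show ?thesis using C(1) by (simp add: field_simps)
  qed
  then have "\<forall>v \<in> carrier_vec n. c * (v \<bullet> v) \<le> qform M v" if "c < 1 / C" for c
    using that by (meson less_imp_le mult_right_mono order_trans scalar_prod_self_nonneg)
  then show ?thesis
    using eventually_at_right_real[of 0 "1 / C"] C(1)
    by (auto elim!: eventually_mono)
qed

section \<open>Inverses and Schur complements\<close>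

abbreviation minv :: "real mat \<Rightarrow> real mat" where
  "minv M \<equiv> the (mat_inverse M)"

lemma minv_minv:
  assumes M: "pos_def_mat n M"
  shows "minv (minv M) = M"
proof -
  note Mc = pos_def_carrier[OF M]
  note R = invertible_mat_inverse[OF Mc pos_def_invertible[OF M]]
  note R' = invertible_mat_inverse[OF R(1) pos_def_invertible[OF pos_def_inverse(1)[OF M]]]
  show ?thesis
    using assoc_mult_mat[OF R'(1) R(1) Mc] R R' Mc by simp
qed

lemma mat_vec_norm_bounded:
  fixes F :: "real mat"
  assumes F: "F \<in> carrier_mat n n"
  shows "\<forall>\<^sub>F C in at_top. \<forall>v \<in> carrier_vec n. (F *\<^sub>v v) \<bullet> (F *\<^sub>v v) \<le> C * (v \<bullet> v)"
proof -
  have "qform (transpose_mat F * 1\<^sub>m n * F) v = (F *\<^sub>v v) \<bullet> (F *\<^sub>v v)" if "v \<in> carrier_vec n" for v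
    using that F by (simp only: qform_congruence[OF F one_carrier_mat that])
      (simp add: qform_mat)
  then show ?thesis
    using qform_bounded[of "transpose_mat F * 1\<^sub>m n * F" n] F
    by (auto elim!: eventually_mono)
qed

text \<open>
  Expanding \<open>0 \<le> qform R (w - z)\<close> for \<open>w = P\<^sup>-\<^sup>1 v\<close> and \<open>z = R\<^sup>-\<^sup>1 v\<close> gives
  \<open>2 * qform P\<^sup>-\<^sup>1 v - qform R w \<le> qform R\<^sup>-\<^sup>1 v\<close>, and \<open>qform R w\<close> is at most \<open>qform P\<^sup>-\<^sup>1 v - \<eta> |w|\<^sup>2\<close>. The
  margin \<open>\<eta>\<close> survives, measured at \<open>P\<^sup>-\<^sup>1 v\<close>.
\<close>

lemma qform_inverse_antitone:
  assumes P: "pos_def_mat n P" and R: "pos_def_mat n R" and v: "v \<in> carrier_vec n"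
    and le: "\<And>w. w \<in> carrier_vec n \<Longrightarrow> qform R w + \<eta> * (w \<bullet> w) \<le> qform P w"
  shows "qform (minv P) v + \<eta> * ((minv P *\<^sub>v v) \<bullet> (minv P *\<^sub>v v)) \<le> qform (minv R) v"
proof -
  define w where "w = minv P *\<^sub>v v"
  define z where "z = minv R *\<^sub>v v"
  note Pi = pos_def_inverse[OF P] and Ri = pos_def_inverse[OF R]
  have w: "w \<in> carrier_vec n" and z: "z \<in> carrier_vec n"
    using pos_def_carrier[OF Pi(1)] pos_def_carrier[OF Ri(1)] v by (auto simp: w_def z_def)
  have "0 \<le> qform R (w - z)" using qform_nonneg[OF R] w z by simp
  also have "\<dots> = qform R w - 2 * (w \<bullet> v) + qform (minv R) v"
    using qform_diff_vec[OF pos_def_sym[OF R] w z] Ri v by (simp add: z_def)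
  also have "w \<bullet> v = qform (minv P) v"
    using Pi(2)[OF v] Pi(4)[OF v] by (simp add: w_def qform_def)
  finally show ?thesis
    using le[OF w] Pi(4)[OF v] by (simp add: w_def)
qed

lemma qform_sym_block:
  assumes "X \<in> carrier_mat n n" "Y \<in> carrier_mat n n" "Z \<in> carrier_mat n n"
    and a: "a \<in> carrier_vec n" and b: "b \<in> carrier_vec n"
  shows "qform (sym_block X Y Z) (a @\<^sub>v b) = qform X a + 2 * (a \<bullet> (Y *\<^sub>v b)) + qform Z b"
proof -
  have "b \<bullet> (transpose_mat Y *\<^sub>v a) = (transpose_mat Y *\<^sub>v a) \<bullet> b"
    by (rule comm_scalar_prod[of _ n]) (use assms in auto)
  also have "\<dots> = a \<bullet> (Y *\<^sub>v b)"
    by (rule transpose_vec_mult_scalar[of _ n n]) (use assms in auto)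
  finally have "b \<bullet> (transpose_mat Y *\<^sub>v a) = a \<bullet> (Y *\<^sub>v b)" .
  moreover have "sym_block X Y Z *\<^sub>v (a @\<^sub>v b) = (X *\<^sub>v a + Y *\<^sub>v b) @\<^sub>v (transpose_mat Y *\<^sub>v a + Z *\<^sub>v b)"
    unfolding sym_block_def by (rule four_block_mat_mult_vec) (use assms in auto)
  moreover have "(a @\<^sub>v b) \<bullet> ((X *\<^sub>v a + Y *\<^sub>v b) @\<^sub>v (transpose_mat Y *\<^sub>v a + Z *\<^sub>v b)) =
      a \<bullet> (X *\<^sub>v a + Y *\<^sub>v b) + b \<bullet> (transpose_mat Y *\<^sub>v a + Z *\<^sub>v b)"
    by (rule scalar_prod_append) (use assms in auto)
  moreover have "a \<bullet> (X *\<^sub>v a + Y *\<^sub>v b) = a \<bullet> (X *\<^sub>v a) + a \<bullet> (Y *\<^sub>v b)"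
    "b \<bullet> (transpose_mat Y *\<^sub>v a + Z *\<^sub>v b) = b \<bullet> (transpose_mat Y *\<^sub>v a) + b \<bullet> (Z *\<^sub>v b)"
    by (rule scalar_prod_add_distrib[of _ n]; use assms in auto)+
  ultimately show ?thesis
    by (simp add: qform_def)
qed

lemma sym_mat_sym_block:
  assumes "sym_mat n X" "Y \<in> carrier_mat n n" "sym_mat n Z"
  shows "sym_mat (n + n) (sym_block X Y Z)"
  using assms
  by (simp add: sym_mat_def sym_block_def transpose_four_block_mat[of _ n n _ n _ n])

lemma append_vec_ball:
  fixes Q :: "'a vec \<Rightarrow> bool"
  shows "(\<forall>v \<in> carrier_vec (n + n). Q v) \<longleftrightarrow> (\<forall>a \<in> carrier_vec n. \<forall>b \<in> carrier_vec n. Q (a @\<^sub>v b))"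
proof (intro iffI ballI)
  fix v :: "'a vec"
  assume "\<forall>a \<in> carrier_vec n. \<forall>b \<in> carrier_vec n. Q (a @\<^sub>v b)" and "v \<in> carrier_vec (n + n)"
  then have "Q (vec_first v n @\<^sub>v vec_last v n)"
    using vec_first_carrier vec_last_carrier by blast
  then show "Q v" by (metis vec_first_last_append \<open>v \<in> carrier_vec (n + n)\<close>)
qed auto

lemma append_vec_eq_zero:
  fixes a b :: "'a :: zero vec"
  assumes "a \<in> carrier_vec n" "b \<in> carrier_vec n"
  shows "a @\<^sub>v b = 0\<^sub>v (n + n) \<longleftrightarrow> a = 0\<^sub>v n \<and> b = 0\<^sub>v n"
proof -
  have "0\<^sub>v (n + n) = 0\<^sub>v n @\<^sub>v (0\<^sub>v n :: 'a vec)" by (intro eq_vecI) auto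
  then show ?thesis using append_vec_eq[OF assms(1) zero_carrier_vec] by simp
qed

context
  fixes n :: nat and S1 S2 Y :: "real mat"
  assumes S1: "sym_mat n S1" and S2: "sym_mat n S2" and Y: "Y \<in> carrier_mat n n"
begin

lemma qform_neg_sym_block:
  assumes "a \<in> carrier_vec n" "b \<in> carrier_vec n"
  shows "qform (0\<^sub>m (n + n) (n + n) - sym_block (- S1) Y (- S2)) (a @\<^sub>v b)
    = qform S1 a + qform S2 b - 2 * (a \<bullet> (Y *\<^sub>v b))"
proof -
  let ?M = "sym_block (- S1) Y (- S2)"
  note C = sym_mat_carrier[OF S1] sym_mat_carrier[OF S2]
  have "?M \<in> carrier_mat (n + n) (n + n)"
    by (rule sym_mat_carrier[OF sym_mat_sym_block[OF sym_mat_intros(4)[OF S1] Y sym_mat_intros(4)[OF S2]]])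
  then have "qform (0\<^sub>m (n + n) (n + n) - ?M) (a @\<^sub>v b) = - qform ?M (a @\<^sub>v b)"
    using qform_mat(2,6)[of "a @\<^sub>v b" "n + n"] assms by simp
  also have "qform ?M (a @\<^sub>v b) = qform (- S1) a + 2 * (a \<bullet> (Y *\<^sub>v b)) + qform (- S2) b"
    by (rule qform_sym_block[of _ n]) (use C Y assms in auto)
  finally show ?thesis
    using qform_mat(4)[OF assms(1) C(1)] qform_mat(4)[OF assms(2) C(2)] by simp
qed

lemma sym_neg_sym_block: "sym_mat (n + n) (0\<^sub>m (n + n) (n + n) - sym_block (- S1) Y (- S2))"
  by (rule sym_mat_intros(2)[OF sym_mat_intros(6)
        sym_mat_sym_block[OF sym_mat_intros(4)[OF S1] Y sym_mat_intros(4)[OF S2]]])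

lemma sym_block_le_iff:
  "sym_block (- S1) Y (- S2) \<preceq>\<^bsub>n + n\<^esub> 0\<^sub>m (n + n) (n + n) \<longleftrightarrow>
    (\<forall>a \<in> carrier_vec n. \<forall>b \<in> carrier_vec n. 2 * (a \<bullet> (Y *\<^sub>v b)) \<le> qform S1 a + qform S2 b)"
  unfolding mat_le_def pos_semidef_qform append_vec_ball
  by (simp only: qform_neg_sym_block sym_neg_sym_block simp_thms le_diff_eq add_0 cong: ball_cong)

lemma sym_block_less_iff:
  "sym_block (- S1) Y (- S2) \<prec>\<^bsub>n + n\<^esub> 0\<^sub>m (n + n) (n + n) \<longleftrightarrow>
    (\<forall>a \<in> carrier_vec n. \<forall>b \<in> carrier_vec n. a \<noteq> 0\<^sub>v n \<or> b \<noteq> 0\<^sub>v n \<longrightarrow>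
      2 * (a \<bullet> (Y *\<^sub>v b)) < qform S1 a + qform S2 b)"
  unfolding mat_less_def pos_def_qform append_vec_ball
  by (simp only: qform_neg_sym_block sym_neg_sym_block append_vec_eq_zero de_Morgan_conj
      simp_thms less_diff_eq add_0 cong: ball_cong)

end

text \<open>
  The form of the negated block matrix, with \<open>F S2\<close> off the diagonal, is a square plus the one-step
  decrease of the inverse weights at \<open>S2 b\<close>. For given \<open>b\<close>, a choice of \<open>a\<close> makes the square
  vanish.
\<close>

lemma complete_square:
  assumes S1: "pos_def_mat n S1" and S2: "pos_def_mat n S2" and F: "F \<in> carrier_mat n n"
    and a: "a \<in> carrier_vec n" and b: "b \<in> carrier_vec n"
  shows "qform S1 a + qform S2 b - 2 * (a \<bullet> (F * S2 *\<^sub>v b)) =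
    qform (minv S1) (S1 *\<^sub>v a - F *\<^sub>v (S2 *\<^sub>v b))
    + (qform (minv S2) (S2 *\<^sub>v b) - qform (minv S1) (F *\<^sub>v (S2 *\<^sub>v b)))"
proof -
  note I1 = pos_def_inverse[OF S1] and I2 = pos_def_inverse[OF S2]
  note C = pos_def_carrier[OF S1] pos_def_carrier[OF S2] pos_def_carrier[OF I1(1)]
  define c where "c = F *\<^sub>v (S2 *\<^sub>v b)"
  have c: "c \<in> carrier_vec n" using F C b by (simp add: c_def)
  have "(S1 *\<^sub>v a) \<bullet> (minv S1 *\<^sub>v c) = c \<bullet> a"
    using sym_mat_swap[OF pos_def_sym[OF I1(1)] _ c, of "S1 *\<^sub>v a"] I1(3)[OF a] a C by simp
  also have "\<dots> = a \<bullet> c" by (rule comm_scalar_prod[OF c a])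
  finally have "qform (minv S1) (S1 *\<^sub>v a - c) = qform S1 a - 2 * (a \<bullet> c) + qform (minv S1) c"
    using qform_diff_vec[OF pos_def_sym[OF I1(1)] _ c, of "S1 *\<^sub>v a"] a C I1(3)[OF a] I1(4)[of "S1 *\<^sub>v a"]
    by simp
  moreover have "qform (minv S2) (S2 *\<^sub>v b) = qform S2 b"
    using I2(3)[OF b] I2(4)[of "S2 *\<^sub>v b"] C b by simp
  moreover have "F * S2 *\<^sub>v b = c"
    using F C b by (simp add: c_def assoc_mult_mat_vec[of _ n n])
  ultimately show ?thesis by (simp add: c_def)
qed

lemma complete_square_critical:
  assumes S1: "pos_def_mat n S1" and S2: "pos_def_mat n S2" and F: "F \<in> carrier_mat n n"
    and v: "v \<in> carrier_vec n"
  defines "a \<equiv> minv S1 *\<^sub>v (F *\<^sub>v v)" and "b \<equiv> minv S2 *\<^sub>v v"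
  shows "a \<in> carrier_vec n" and "b \<in> carrier_vec n" and "v \<noteq> 0\<^sub>v n \<Longrightarrow> b \<noteq> 0\<^sub>v n"
    and "qform S1 a + qform S2 b - 2 * (a \<bullet> (F * S2 *\<^sub>v b)) =
      qform (minv S2) v - qform (minv S1) (F *\<^sub>v v)"
proof -
  note I1 = pos_def_inverse[OF S1] and I2 = pos_def_inverse[OF S2]
  note C = pos_def_carrier[OF S1] pos_def_carrier[OF S2] pos_def_carrier[OF I1(1)]
    pos_def_carrier[OF I2(1)]
  show a: "a \<in> carrier_vec n" and b: "b \<in> carrier_vec n"
    using C F v by (auto simp: a_def b_def)
  have Sb: "S2 *\<^sub>v b = v" using I2(2)[OF v] by (simp add: b_def)
  then show "b \<noteq> 0\<^sub>v n" if "v \<noteq> 0\<^sub>v n"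
    using that C by (metis mult_mat_zero_vec)
  have Sa: "S1 *\<^sub>v a = F *\<^sub>v v" using I1(2)[of "F *\<^sub>v v"] F v by (simp add: a_def)
  have "F *\<^sub>v v - F *\<^sub>v v = 0\<^sub>v n" using F v by (intro eq_vecI) auto
  moreover have "qform (minv S1) (0\<^sub>v n) = 0"
    using C by (simp add: qform_def mult_mat_zero_vec)
  ultimately show "qform S1 a + qform S2 b - 2 * (a \<bullet> (F * S2 *\<^sub>v b)) =
      qform (minv S2) v - qform (minv S1) (F *\<^sub>v v)"
    using complete_square[OF S1 S2 F a b] by (simp only: Sa Sb)
qed

text \<open>
  A Schur complement: since \<open>S1\<close> and \<open>S2\<close> are invertible, the vectors at which the square vanishes
  already test the decrease at every \<open>v\<close>.
\<close>

lemma schur_le_iff: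
  assumes S1: "pos_def_mat n S1" and S2: "pos_def_mat n S2" and F: "F \<in> carrier_mat n n"
  shows "sym_block (- S1) (F * S2) (- S2) \<preceq>\<^bsub>n + n\<^esub> 0\<^sub>m (n + n) (n + n) \<longleftrightarrow>
    (\<forall>v \<in> carrier_vec n. qform (minv S1) (F *\<^sub>v v) \<le> qform (minv S2) v)"
    (is "?lmi \<longleftrightarrow> ?lyap")
proof -
  note I1 = pos_def_inverse[OF S1] and I2 = pos_def_inverse[OF S2]
  note C = pos_def_carrier[OF S1] pos_def_carrier[OF S2] pos_def_carrier[OF I1(1)]
    pos_def_carrier[OF I2(1)]
  note sq = complete_square[OF assms]
  have "?lmi \<longleftrightarrow> (\<forall>a \<in> carrier_vec n. \<forall>b \<in> carrier_vec n.
      2 * (a \<bullet> (F * S2 *\<^sub>v b)) \<le> qform S1 a + qform S2 b)"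
    by (rule sym_block_le_iff) (use S1 S2 F C in \<open>auto simp: pos_def_sym\<close>)
  also have "\<dots> \<longleftrightarrow> ?lyap"
  proof safe
    fix v :: "real vec"
    assume *: "\<forall>a \<in> carrier_vec n. \<forall>b \<in> carrier_vec n.
      2 * (a \<bullet> (F * S2 *\<^sub>v b)) \<le> qform S1 a + qform S2 b" and v: "v \<in> carrier_vec n"
    note crit = complete_square_critical[OF assms v]
    show "qform (minv S1) (F *\<^sub>v v) \<le> qform (minv S2) v"
      using * crit by fastforce
  next
    fix a b :: "real vec"
    assume ?lyap and ab: "a \<in> carrier_vec n" "b \<in> carrier_vec n"
    then have "0 \<le> qform (minv S2) (S2 *\<^sub>v b) - qform (minv S1) (F *\<^sub>v (S2 *\<^sub>v b))"
      using C by simp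
    moreover have "0 \<le> qform (minv S1) (S1 *\<^sub>v a - F *\<^sub>v (S2 *\<^sub>v b))"
      using qform_nonneg[OF I1(1)] C F ab by simp
    ultimately show "2 * (a \<bullet> (F * S2 *\<^sub>v b)) \<le> qform S1 a + qform S2 b"
      using sq[OF ab] by simp
  qed
  finally show ?thesis .
qed

lemma schur_less_iff:
  assumes S1: "pos_def_mat n S1" and S2: "pos_def_mat n S2" and F: "F \<in> carrier_mat n n"
  shows "sym_block (- S1) (F * S2) (- S2) \<prec>\<^bsub>n + n\<^esub> 0\<^sub>m (n + n) (n + n) \<longleftrightarrow>
    (\<forall>v \<in> carrier_vec n. v \<noteq> 0\<^sub>v n \<longrightarrow> qform (minv S1) (F *\<^sub>v v) < qform (minv S2) v)"
    (is "?lmi \<longleftrightarrow> ?lyap")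
proof -
  note I1 = pos_def_inverse[OF S1] and I2 = pos_def_inverse[OF S2]
  note C = pos_def_carrier[OF S1] pos_def_carrier[OF S2] pos_def_carrier[OF I1(1)]
    pos_def_carrier[OF I2(1)]
  note sq = complete_square[OF assms]
  have "?lmi \<longleftrightarrow> (\<forall>a \<in> carrier_vec n. \<forall>b \<in> carrier_vec n. a \<noteq> 0\<^sub>v n \<or> b \<noteq> 0\<^sub>v n \<longrightarrow>
      2 * (a \<bullet> (F * S2 *\<^sub>v b)) < qform S1 a + qform S2 b)"
    by (rule sym_block_less_iff) (use S1 S2 F C in \<open>auto simp: pos_def_sym\<close>)
  also have "\<dots> \<longleftrightarrow> ?lyap"
  proof (intro iffI ballI impI)
    fix v :: "real vec"
    assume *: "\<forall>a \<in> carrier_vec n. \<forall>b \<in> carrier_vec n. a \<noteq> 0\<^sub>v n \<or> b \<noteq> 0\<^sub>v n \<longrightarrow>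
      2 * (a \<bullet> (F * S2 *\<^sub>v b)) < qform S1 a + qform S2 b"
      and v: "v \<in> carrier_vec n" and v0: "v \<noteq> 0\<^sub>v n"
    note crit = complete_square_critical[OF assms v]
    show "qform (minv S1) (F *\<^sub>v v) < qform (minv S2) v"
      using * crit(1,2,4) crit(3)[OF v0] by fastforce
  next
    fix a b :: "real vec"
    assume lyap: ?lyap and ab: "a \<in> carrier_vec n" "b \<in> carrier_vec n"
      and nz: "a \<noteq> 0\<^sub>v n \<or> b \<noteq> 0\<^sub>v n"
    show "2 * (a \<bullet> (F * S2 *\<^sub>v b)) < qform S1 a + qform S2 b"
    proof (cases "b = 0\<^sub>v n")
      case True
      then have "0 < qform S1 a" using nz S1 ab by (auto simp: pos_def_qform)
      then show ?thesis
        using True F C ab by (simp add: qform_def mult_mat_zero_vec[of _ n])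
    next
      case False
      have "S2 *\<^sub>v b \<noteq> 0\<^sub>v n" using I2(3)[OF ab(2)] False C by (metis mult_mat_zero_vec)
      then have "0 < qform (minv S2) (S2 *\<^sub>v b) - qform (minv S1) (F *\<^sub>v (S2 *\<^sub>v b))"
        using lyap C ab by simp
      moreover have "0 \<le> qform (minv S1) (S1 *\<^sub>v a - F *\<^sub>v (S2 *\<^sub>v b))"
        using qform_nonneg[OF I1(1)] C F ab by simp
      ultimately show ?thesis
        using sq[OF ab] by simp
    qed
  qed
  finally show ?thesis .
qed

section \<open>Lyapunov certificates\<close>

text \<open>
  The index \<open>min (Suc k) \<tau>\<close> lets one inequality cover both the steps of the minimal dwell period
  and, for \<open>k = \<tau>\<close>, every later step in the same mode.
\<close>

definition lyapunov_certificate ::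
    "nat \<Rightarrow> nat \<Rightarrow> nat \<Rightarrow> (nat \<Rightarrow> nat \<Rightarrow> real mat) \<Rightarrow> (nat \<Rightarrow> nat \<Rightarrow> real mat) \<Rightarrow> real \<Rightarrow> bool" where
  "lyapunov_certificate N \<tau> n F Q \<eta> \<longleftrightarrow> 0 < \<eta> \<and>
     (\<forall>i \<in> {1..N}. \<forall>k \<le> \<tau>. pos_def_mat n (Q i k)) \<and>
     (\<forall>i \<in> {1..N}. \<forall>k \<le> \<tau>. \<forall>v \<in> carrier_vec n.
        qform (Q i (min (Suc k) \<tau>)) (F i k *\<^sub>v v) + \<eta> * (v \<bullet> v) \<le> qform (Q i k) v) \<and>
     (\<forall>i \<in> {1..N}. \<forall>j \<in> {1..N}. i \<noteq> j \<longrightarrow> (\<forall>v \<in> carrier_vec n.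
        qform (Q i 0) v + \<eta> * (v \<bullet> v) \<le> qform (Q j \<tau>) v))"

lemma cl_mat_carrier:
  assumes "A i \<in> carrier_mat n n" "B i \<in> carrier_mat n k" "K i t \<in> carrier_mat k n"
  shows "cl_mat A B K i t \<in> carrier_mat n n"
  using assms by (auto simp: cl_mat_def)

lemma Psi_carrier:
  assumes "\<And>k. k < t \<Longrightarrow> cl_mat A B K i k \<in> carrier_mat n n"
  shows "Psi n A B K i t \<in> carrier_mat n n"
  using assms by (induction t) (auto intro!: mult_carrier_mat[of _ n n])

text \<open>
  One step before \<open>P\<close> the weight is \<open>F' P F + \<rho> I\<close>: the form then drops by \<open>\<rho> |v|\<^sup>2\<close> in the step
  under \<open>F\<close>, and the weight stays positive definite even if \<open>F\<close> is singular. Each such step spends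
  half of what is left of the tolerance \<open>\<delta>\<close> by which the initial weight may exceed \<open>\<Psi>' P \<Psi>\<close>.
\<close>

lemma backward_lyapunov_sequence:
  assumes "\<And>k. k < \<tau> \<Longrightarrow> cl_mat A B K i k \<in> carrier_mat n n"
    and "pos_def_mat n P" and "0 < \<delta>"
  shows "\<exists>Q \<eta>. 0 < \<eta> \<and> Q \<tau> = P \<and> (\<forall>k \<le> \<tau>. pos_def_mat n (Q k)) \<and>
    (\<forall>k < \<tau>. \<forall>v \<in> carrier_vec n.
      qform (Q (Suc k)) (cl_mat A B K i k *\<^sub>v v) + \<eta> * (v \<bullet> v) \<le> qform (Q k) v) \<and>
    (\<forall>v \<in> carrier_vec n. qform (Q 0) v \<le> qform P (Psi n A B K i \<tau> *\<^sub>v v) + \<delta> * (v \<bullet> v))"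
  using assms
proof (induction \<tau> arbitrary: P \<delta>)
  case 0
  then show ?case
    by (intro exI[of _ "\<lambda>_. P"] exI[of _ 1]) (auto intro: mult_nonneg_nonneg scalar_prod_self_nonneg)
next
  case (Suc \<tau>)
  let ?F = "cl_mat A B K i \<tau>"
  let ?\<Psi> = "Psi n A B K i \<tau>"
  have F: "?F \<in> carrier_mat n n" and \<Psi>: "?\<Psi> \<in> carrier_mat n n"
    using Suc.prems(1) by (auto intro: Psi_carrier)
  note P = Suc.prems(2)
  obtain C where C: "0 < C" "\<forall>v \<in> carrier_vec n. (?\<Psi> *\<^sub>v v) \<bullet> (?\<Psi> *\<^sub>v v) \<le> C * (v \<bullet> v)"
    using eventually_happens[OF eventually_conj[OF eventually_gt_at_top[of 0]
          mat_vec_norm_bounded[OF \<Psi>]]] by auto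
  \<comment> \<open>the extra term at \<open>\<Psi> v\<close> is at most \<open>\<rho> C |v|\<^sup>2\<close>, half of the tolerance\<close>
  define \<rho> where "\<rho> = \<delta> / (2 * C)"
  have \<rho>: "0 < \<rho>" using C(1) Suc.prems(3) by (simp add: \<rho>_def)
  define P' where "P' = transpose_mat ?F * P * ?F + \<rho> \<cdot>\<^sub>m 1\<^sub>m n"
  have FPF: "sym_mat n (transpose_mat ?F * P * ?F)"
    by (rule sym_mat_intros(7)[OF pos_def_sym[OF P] F])
  have P'_form: "qform P' v = qform P (?F *\<^sub>v v) + \<rho> * (v \<bullet> v)" if v: "v \<in> carrier_vec n" for v
    using qform_mat(1)[OF v sym_mat_carrier[OF FPF], of "\<rho> \<cdot>\<^sub>m 1\<^sub>m n"]
      qform_mat(3)[OF v, of "1\<^sub>m n" \<rho>] qform_mat(5)[OF v] qform_congruence[OF F pos_def_carrier[OF P] v]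
    by (simp add: P'_def)
  have "pos_def_mat n P'"
    unfolding pos_def_qform
  proof (intro conjI ballI impI)
    show "sym_mat n P'"
      unfolding P'_def by (rule sym_mat_intros(1)[OF FPF sym_mat_intros(3)[OF sym_mat_intros(5)]])
    fix v :: "real vec" assume v: "v \<in> carrier_vec n" "v \<noteq> 0\<^sub>v n"
    show "0 < qform P' v"
      using P'_form[OF v(1)] qform_nonneg[OF P, of "?F *\<^sub>v v"] F v(1)
        mult_pos_pos[OF \<rho> scalar_prod_self_pos[OF v]] by simp
  qed
  then obtain Q \<eta> where Q: "0 < \<eta>" "Q \<tau> = P'" "\<forall>k \<le> \<tau>. pos_def_mat n (Q k)"
    "\<And>k v. k < \<tau> \<Longrightarrow> v \<in> carrier_vec n \<Longrightarrow>
      qform (Q (Suc k)) (cl_mat A B K i k *\<^sub>v v) + \<eta> * (v \<bullet> v) \<le> qform (Q k) v"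
    "\<And>v. v \<in> carrier_vec n \<Longrightarrow> qform (Q 0) v \<le> qform P' (?\<Psi> *\<^sub>v v) + \<delta> / 2 * (v \<bullet> v)"
    using Suc.IH[of P' "\<delta> / 2"] Suc.prems(1,3) by (auto simp: less_Suc_eq)
  define Q' where "Q' = Q(Suc \<tau> := P)"
  define \<eta>' where "\<eta>' = min \<eta> \<rho>"
  have le: "\<eta>' * (v \<bullet> v) \<le> \<eta> * (v \<bullet> v)" "\<eta>' * (v \<bullet> v) \<le> \<rho> * (v \<bullet> v)" for v :: "real vec"
    by (auto simp: \<eta>'_def intro!: mult_right_mono scalar_prod_self_nonneg)
  have "qform (Q' (Suc k)) (cl_mat A B K i k *\<^sub>v v) + \<eta>' * (v \<bullet> v) \<le> qform (Q' k) v"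
    if "k < Suc \<tau>" and v: "v \<in> carrier_vec n" for k v
  proof (cases "k = \<tau>")
    case True
    then show ?thesis using P'_form[OF v] Q(2) le(2)[of v] by (simp add: Q'_def)
  next
    case False
    then show ?thesis using that Q(4)[of k v] le(1)[of v] by (simp add: Q'_def)
  qed
  moreover have "qform (Q' 0) v \<le> qform P (Psi n A B K i (Suc \<tau>) *\<^sub>v v) + \<delta> * (v \<bullet> v)"
    if v: "v \<in> carrier_vec n" for v
  proof -
    have w: "?\<Psi> *\<^sub>v v \<in> carrier_vec n" using \<Psi> v by simp
    have "\<rho> * ((?\<Psi> *\<^sub>v v) \<bullet> (?\<Psi> *\<^sub>v v)) \<le> \<rho> * (C * (v \<bullet> v))"
      using C(2) v \<rho> by (intro mult_left_mono) auto
    also have "\<dots> = \<delta> / 2 * (v \<bullet> v)" using C(1) by (simp add: \<rho>_def)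
    finally have "qform P' (?\<Psi> *\<^sub>v v) \<le> qform P (?F *\<^sub>v (?\<Psi> *\<^sub>v v)) + \<delta> / 2 * (v \<bullet> v)"
      using P'_form[OF w] by simp
    moreover have "Psi n A B K i (Suc \<tau>) *\<^sub>v v = ?F *\<^sub>v (?\<Psi> *\<^sub>v v)"
      using F \<Psi> v by simp
    moreover have "Q' 0 = Q 0" by (simp add: Q'_def)
    ultimately show ?thesis using Q(5)[OF v] by simp
  qed
  moreover have "0 < \<eta>'" using Q(1) \<rho> by (simp add: \<eta>'_def)
  moreover have "\<forall>k \<le> Suc \<tau>. pos_def_mat n (Q' k)" using Q(3) P by (auto simp: Q'_def le_Suc_eq)
  moreover have "Q' (Suc \<tau>) = P" by (simp add: Q'_def)
  ultimately show ?case by (intro exI[of _ Q'] exI[of _ \<eta>']) auto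
qed

lemma qform_congruence_gap:
  assumes F: "F \<in> carrier_mat n n" and P: "sym_mat n P" and R: "sym_mat n R" and v: "v \<in> carrier_vec n"
  shows "qform (0\<^sub>m n n - (transpose_mat F * P * F - R)) v = qform R v - qform P (F *\<^sub>v v)"
  using qform_mat(2)[OF v sym_mat_carrier[OF sym_mat_intros(7)[OF P F]] sym_mat_carrier[OF R]]
    qform_mat(2)[OF v zero_carrier_mat[of n n], of "transpose_mat F * P * F - R"]
    qform_mat(6)[OF v] qform_congruence[OF F sym_mat_carrier[OF P] v] sym_mat_carrier[OF R]
  by (simp add: minus_carrier_mat)

lemma congruence_decrease_coercive:
  assumes F: "F \<in> carrier_mat n n" and P: "sym_mat n P" and R: "sym_mat n R"
    and less: "transpose_mat F * P * F - R \<prec>\<^bsub>n\<^esub> 0\<^sub>m n n"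
  shows "\<forall>\<^sub>F c in at_right 0. \<forall>v \<in> carrier_vec n. qform P (F *\<^sub>v v) + c * (v \<bullet> v) \<le> qform R v"
proof (rule eventually_mono[OF pos_def_coercive[OF less[unfolded mat_less_def]]], intro ballI)
  fix c and v :: "real vec"
  assume c: "\<forall>v \<in> carrier_vec n. c * (v \<bullet> v) \<le> qform (0\<^sub>m n n - (transpose_mat F * P * F - R)) v"
    and v: "v \<in> carrier_vec n"
  show "qform P (F *\<^sub>v v) + c * (v \<bullet> v) \<le> qform R v"
    using bspec[OF c v] qform_congruence_gap[OF F P R v] by simp
qed

lemma congruence_decreaseI:
  assumes F: "F \<in> carrier_mat n n" and P: "sym_mat n P" and R: "sym_mat n R"
    and less: "\<And>v. v \<in> carrier_vec n \<Longrightarrow> v \<noteq> 0\<^sub>v n \<Longrightarrow> qform P (F *\<^sub>v v) < qform R v"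
  shows "transpose_mat F * P * F - R \<prec>\<^bsub>n\<^esub> 0\<^sub>m n n"
  unfolding mat_less_def pos_def_qform
  using less sym_mat_intros(2)[OF sym_mat_intros(6) sym_mat_intros(2)[OF sym_mat_intros(7)[OF P F] R]]
  by (simp add: qform_congruence_gap[OF F P R])

text \<open>
  Strictness of all gain inequalities yields a common margin \<open>c\<close>. The backward sequences may use
  \<open>c / 2\<close> of it for their excess over \<open>\<Psi>' P i \<Psi>\<close>; the other half remains as the gap at a switch.
\<close>

lemma gain_imp_certificate:
  assumes N: "N \<ge> 2"
    and A: "\<forall>i \<in> {1..N}. A i \<in> carrier_mat n n"
    and B: "\<forall>i \<in> {1..N}. B i \<in> carrier_mat n (m i)"
    and gain: "gain_condition N \<tau> n m A B P K"
  shows "\<exists>Q \<eta>. lyapunov_certificate N \<tau> n (cl_mat A B K) Q \<eta>"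
proof -
  note A = bspec[OF A] and B = bspec[OF B]
  let ?I = "{1..N}"
  let ?F = "cl_mat A B K"
  let ?\<Psi> = "\<lambda>i. Psi n A B K i \<tau>"
  have P: "pos_def_mat n (P i)" if "i \<in> ?I" for i
    using gain that by (simp add: gain_condition_def)
  have F: "?F i k \<in> carrier_mat n n" if "i \<in> ?I" "k \<le> \<tau>" for i k
    by (rule cl_mat_carrier[OF A B]) (use gain that in \<open>auto simp: gain_condition_def\<close>)
  have \<Psi>: "?\<Psi> i \<in> carrier_mat n n" if "i \<in> ?I" for i
    using F that by (intro Psi_carrier) auto
  have less: "transpose_mat (?F i \<tau>) * P i * ?F i \<tau> - P i \<prec>\<^bsub>n\<^esub> 0\<^sub>m n n"
    "transpose_mat (?\<Psi> i) * P i * ?\<Psi> i - P j \<prec>\<^bsub>n\<^esub> 0\<^sub>m n n"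
    if "i \<in> ?I" "j \<in> ?I" "i \<noteq> j" for i j
    using gain that by (auto simp: gain_condition_def)
  have ev1: "\<forall>\<^sub>F c in at_right 0. \<forall>v \<in> carrier_vec n. qform (P i) (?F i \<tau> *\<^sub>v v) + c * (v \<bullet> v) \<le> qform (P i) v"
    if i: "i \<in> ?I" for i
  proof -
    obtain j where "j \<in> ?I" "i \<noteq> j"
      using N that[of "if i = 1 then 2 else 1"] by (auto split: if_splits)
    then show ?thesis
      using congruence_decrease_coercive[OF F pos_def_sym[OF P] pos_def_sym[OF P] less(1)] i by blast
  qed
  have ev2: "\<forall>\<^sub>F c in at_right 0. i \<noteq> j \<longrightarrow>
      (\<forall>v \<in> carrier_vec n. qform (P i) (?\<Psi> i *\<^sub>v v) + c * (v \<bullet> v) \<le> qform (P j) v)"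
    if "i \<in> ?I" "j \<in> ?I" for i j
    using congruence_decrease_coercive[OF \<Psi> pos_def_sym[OF P] pos_def_sym[OF P] less(2)] that
    by (cases "i = j") auto
  have ev: "\<forall>\<^sub>F c in at_right (0 :: real). 0 < c \<and>
      (\<forall>i \<in> ?I. \<forall>v \<in> carrier_vec n. qform (P i) (?F i \<tau> *\<^sub>v v) + c * (v \<bullet> v) \<le> qform (P i) v) \<and>
      (\<forall>i \<in> ?I. \<forall>j \<in> ?I. i \<noteq> j \<longrightarrow>
        (\<forall>v \<in> carrier_vec n. qform (P i) (?\<Psi> i *\<^sub>v v) + c * (v \<bullet> v) \<le> qform (P j) v))"
    using eventually_ball_finite[of ?I, OF _ ballI[OF ev1]]
      eventually_ball_finite[of ?I, OF _ ballI[OF eventually_ball_finite[of ?I, OF _ ballI[OF ev2]]]]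
    by (intro eventually_conj eventually_at_right_less) auto
  obtain c where c: "0 < c"
    "\<And>i v. i \<in> ?I \<Longrightarrow> v \<in> carrier_vec n \<Longrightarrow> qform (P i) (?F i \<tau> *\<^sub>v v) + c * (v \<bullet> v) \<le> qform (P i) v"
    "\<And>i j v. i \<in> ?I \<Longrightarrow> j \<in> ?I \<Longrightarrow> i \<noteq> j \<Longrightarrow> v \<in> carrier_vec n \<Longrightarrow>
      qform (P i) (?\<Psi> i *\<^sub>v v) + c * (v \<bullet> v) \<le> qform (P j) v"
    using eventually_happens'[OF trivial_limit_at_right_real ev] by auto
  let ?seq = "\<lambda>i Q \<eta>. 0 < \<eta> \<and> Q \<tau> = P i \<and> (\<forall>k \<le> \<tau>. pos_def_mat n (Q k)) \<and>
    (\<forall>k < \<tau>. \<forall>v \<in> carrier_vec n.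
      qform (Q (Suc k)) (?F i k *\<^sub>v v) + \<eta> * (v \<bullet> v) \<le> qform (Q k) v) \<and>
    (\<forall>v \<in> carrier_vec n. qform (Q 0) v \<le> qform (P i) (?\<Psi> i *\<^sub>v v) + c / 2 * (v \<bullet> v))"
  have "\<forall>i \<in> ?I. \<exists>Q \<eta>. ?seq i Q \<eta>"
    using F P c(1) by (intro ballI backward_lyapunov_sequence) auto
  then obtain Q \<eta> where seq: "\<forall>i \<in> ?I. ?seq i (Q i) (\<eta> i)"
    unfolding bchoice_iff by blast
  have Q: "\<And>i. i \<in> ?I \<Longrightarrow> 0 < \<eta> i" "\<And>i. i \<in> ?I \<Longrightarrow> Q i \<tau> = P i"
    "\<And>i k. i \<in> ?I \<Longrightarrow> k \<le> \<tau> \<Longrightarrow> pos_def_mat n (Q i k)"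
    "\<And>i k v. i \<in> ?I \<Longrightarrow> k < \<tau> \<Longrightarrow> v \<in> carrier_vec n \<Longrightarrow>
      qform (Q i (Suc k)) (?F i k *\<^sub>v v) + \<eta> i * (v \<bullet> v) \<le> qform (Q i k) v"
    "\<And>i v. i \<in> ?I \<Longrightarrow> v \<in> carrier_vec n \<Longrightarrow>
      qform (Q i 0) v \<le> qform (P i) (?\<Psi> i *\<^sub>v v) + c / 2 * (v \<bullet> v)"
    using seq by blast+
  define \<mu> where "\<mu> = Min (insert (c / 2) (\<eta> ` ?I))"
  have \<mu>: "0 < \<mu>" "\<mu> \<le> c / 2" "\<And>i. i \<in> ?I \<Longrightarrow> \<mu> \<le> \<eta> i"
  proof -
    show "0 < \<mu>" using c(1) Q(1) by (simp add: \<mu>_def)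
    show "\<mu> \<le> c / 2" unfolding \<mu>_def by (rule Min_le) auto
    show "\<mu> \<le> \<eta> i" if "i \<in> ?I" for i unfolding \<mu>_def by (rule Min_le) (use that in auto)
  qed
  have le: "\<mu> * (v \<bullet> v) \<le> c / 2 * (v \<bullet> v)" "i \<in> ?I \<Longrightarrow> \<mu> * (v \<bullet> v) \<le> \<eta> i * (v \<bullet> v)"
    for v :: "real vec" and i
    by (rule mult_right_mono[OF _ scalar_prod_self_nonneg], rule \<mu>, assumption?)+
  have nonneg: "0 \<le> c / 2 * (v \<bullet> v)" for v :: "real vec"
    using c(1) scalar_prod_self_nonneg[of v] by simp
  have "qform (Q i (min (Suc k) \<tau>)) (?F i k *\<^sub>v v) + \<mu> * (v \<bullet> v) \<le> qform (Q i k) v"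
    if i: "i \<in> ?I" and "k \<le> \<tau>" and v: "v \<in> carrier_vec n" for i k v
  proof (cases "k = \<tau>")
    case True
    then show ?thesis using c(2)[OF i v] le(1)[of v] nonneg[of v] Q(2)[OF i] by simp
  next
    case False
    then have "k < \<tau>" "min (Suc k) \<tau> = Suc k" using that by auto
    then show ?thesis using Q(4)[OF i _ v, of k] le(2)[OF i, of v] by simp
  qed
  moreover have "qform (Q i 0) v + \<mu> * (v \<bullet> v) \<le> qform (Q j \<tau>) v"
    if "i \<in> ?I" "j \<in> ?I" "i \<noteq> j" "v \<in> carrier_vec n" for i j v
    using Q(5)[of i v] c(3)[of i j v] le(1)[of v] Q(2)[of j] that by simp
  ultimately have "lyapunov_certificate N \<tau> n ?F Q \<mu>"
    using \<mu>(1) Q(3) by (simp add: lyapunov_certificate_def)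
  then show ?thesis by blast
qed

lemma closed_loop_factor:
  assumes "A i \<in> carrier_mat n n" "B i \<in> carrier_mat n k" "K i t \<in> carrier_mat k n"
    and "S \<in> carrier_mat n n"
  shows "A i * S + B i * (K i t * S) = cl_mat A B K i t * S"
  using assms
  by (simp add: cl_mat_def add_mult_distrib_mat[of _ n n _ _ n] assoc_mult_mat[of _ n k _ n _ n])

lemma lmi_gap_iff:
  assumes "sym_mat n S" and "sym_mat n T"
  shows "S - T + c \<cdot>\<^sub>m 1\<^sub>m n \<preceq>\<^bsub>n\<^esub> 0\<^sub>m n n \<longleftrightarrow>
    (\<forall>v \<in> carrier_vec n. qform S v + c * (v \<bullet> v) \<le> qform T v)"
proof -
  have sym: "sym_mat n (S - T + c \<cdot>\<^sub>m 1\<^sub>m n)"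
    by (intro sym_mat_intros assms)
  have "qform (0\<^sub>m n n - (S - T + c \<cdot>\<^sub>m 1\<^sub>m n)) v = qform T v - (qform S v + c * (v \<bullet> v))"
    if v: "v \<in> carrier_vec n" for v
    using sym_mat_carrier[OF sym] sym_mat_carrier[OF assms(1)] sym_mat_carrier[OF assms(2)]
    by (simp add: qform_mat[OF v] minus_carrier_mat)
  then show ?thesis
    unfolding mat_le_def pos_semidef_qform
    using sym_mat_intros(2)[OF sym_mat_intros(6) sym] by simp
qed

text \<open>
  Inverting the weights turns the decrease into the block inequalities and the gap \<open>\<eta>\<close> at a switch
  into \<open>\<eta> |S j \<tau> v|\<^sup>2\<close>, which is at least \<open>\<eta> / C * |v|\<^sup>2\<close> when \<open>|Q j \<tau> w|\<^sup>2 \<le> C |w|\<^sup>2\<close> for all \<open>w\<close>.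
\<close>

lemma certificate_imp_lmi:
  assumes "\<tau> \<ge> 1"
    and A: "\<forall>i \<in> {1..N}. A i \<in> carrier_mat n n"
    and B: "\<forall>i \<in> {1..N}. B i \<in> carrier_mat n (m i)"
    and K: "\<forall>i \<in> {1..N}. \<forall>k \<le> \<tau>. K i k \<in> carrier_mat (m i) n"
    and cert: "lyapunov_certificate N \<tau> n (cl_mat A B K) Q \<eta>"
  defines "S \<equiv> \<lambda>i k. minv (Q i k)" and "U \<equiv> \<lambda>i k. K i k * minv (Q i k)"
  shows "\<exists>\<epsilon>. lmi_condition N \<tau> n m A B S U \<epsilon>"
proof -
  note A = bspec[OF A] and B = bspec[OF B] and K = K[rule_format]
  let ?I = "{1..N}"
  let ?F = "cl_mat A B K"
  have \<eta>: "0 < \<eta>"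
    and Q: "\<And>i k. i \<in> ?I \<Longrightarrow> k \<le> \<tau> \<Longrightarrow> pos_def_mat n (Q i k)"
    and dec: "\<And>i k v. i \<in> ?I \<Longrightarrow> k \<le> \<tau> \<Longrightarrow> v \<in> carrier_vec n \<Longrightarrow>
        qform (Q i (min (Suc k) \<tau>)) (?F i k *\<^sub>v v) + \<eta> * (v \<bullet> v) \<le> qform (Q i k) v"
    and jump: "\<And>i j v. i \<in> ?I \<Longrightarrow> j \<in> ?I \<Longrightarrow> i \<noteq> j \<Longrightarrow> v \<in> carrier_vec n \<Longrightarrow>
        qform (Q i 0) v + \<eta> * (v \<bullet> v) \<le> qform (Q j \<tau>) v"
    using cert by (auto simp: lyapunov_certificate_def)
  have F: "?F i k \<in> carrier_mat n n" if "i \<in> ?I" "k \<le> \<tau>" for i k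
    by (rule cl_mat_carrier[OF A B K]) (use that in auto)
  have S: "pos_def_mat n (S i k)" "minv (S i k) = Q i k" if "i \<in> ?I" "k \<le> \<tau>" for i k
    using pos_def_inverse(1)[OF Q[OF that]] minv_minv[OF Q[OF that]] by (auto simp: S_def)
  have fac: "A i * S i k + B i * U i k = ?F i k * S i k" if "i \<in> ?I" "k \<le> \<tau>" for i k
    unfolding S_def U_def
    by (rule closed_loop_factor[OF A B K]) (use that pos_def_carrier[OF S(1)] in \<open>auto simp: S_def\<close>)
  have U: "U i k \<in> carrier_mat (m i) n" if "i \<in> ?I" "k \<le> \<tau>" for i k
    using K[OF that] pos_def_carrier[OF S(1)[OF that]] by (auto simp: U_def S_def)
  have strict: "sym_block (- S i \<tau>) (A i * S i \<tau> + B i * U i \<tau>) (- S i \<tau>) \<prec>\<^bsub>n + n\<^esub> 0\<^sub>m (n + n) (n + n)"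
    if i: "i \<in> ?I" for i
    unfolding fac[OF i order_refl]
  proof (subst schur_less_iff[OF S(1)[OF i order_refl] S(1)[OF i order_refl] F[OF i order_refl]], intro ballI impI)
    fix v :: "real vec" assume v: "v \<in> carrier_vec n" "v \<noteq> 0\<^sub>v n"
    show "qform (minv (S i \<tau>)) (?F i \<tau> *\<^sub>v v) < qform (minv (S i \<tau>)) v"
      using dec[OF i order_refl v(1)] mult_pos_pos[OF \<eta> scalar_prod_self_pos[OF v]] S(2)[OF i order_refl]
      by simp
  qed
  have weak: "sym_block (- S i (Suc k)) (A i * S i k + B i * U i k) (- S i k) \<preceq>\<^bsub>n + n\<^esub> 0\<^sub>m (n + n) (n + n)"
    if i: "i \<in> ?I" and k: "k < \<tau>" for i k
  proof -
    have k': "k \<le> \<tau>" "Suc k \<le> \<tau>" using k by auto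
    show ?thesis
      unfolding fac[OF i k'(1)]
    proof (subst schur_le_iff[OF S(1)[OF i k'(2)] S(1)[OF i k'(1)] F[OF i k'(1)]], intro ballI)
      fix v :: "real vec" assume v: "v \<in> carrier_vec n"
      have "0 \<le> \<eta> * (v \<bullet> v)" using \<eta> scalar_prod_self_nonneg[of v] by simp
      then show "qform (minv (S i (Suc k))) (?F i k *\<^sub>v v) \<le> qform (minv (S i k)) v"
        using dec[OF i k'(1) v] S(2)[OF i k'(1)] S(2)[OF i k'(2)] k by (simp add: min_absorb1)
    qed
  qed
  have ev: "\<forall>\<^sub>F C in at_top. 0 < C \<and> (\<forall>j \<in> ?I. \<forall>v \<in> carrier_vec n.
      (Q j \<tau> *\<^sub>v v) \<bullet> (Q j \<tau> *\<^sub>v v) \<le> C * (v \<bullet> v))"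
    using Q by (intro eventually_conj eventually_gt_at_top eventually_ball_finite ballI
        mat_vec_norm_bounded) (auto simp: pos_def_carrier)
  obtain C where C: "0 < C"
    "\<And>j v. j \<in> ?I \<Longrightarrow> v \<in> carrier_vec n \<Longrightarrow> (Q j \<tau> *\<^sub>v v) \<bullet> (Q j \<tau> *\<^sub>v v) \<le> C * (v \<bullet> v)"
    using eventually_happens'[OF trivial_limit_at_top_linorder ev] by auto
  have gap: "S j \<tau> - S i 0 + (\<eta> / C) \<cdot>\<^sub>m 1\<^sub>m n \<preceq>\<^bsub>n\<^esub> 0\<^sub>m n n"
    if i: "i \<in> ?I" and j: "j \<in> ?I" and ij: "i \<noteq> j" for i j
  proof -
    note Sj = S(1)[OF j order_refl] and Si = S(1)[OF i le0]
    have "qform (S j \<tau>) v + \<eta> / C * (v \<bullet> v) \<le> qform (S i 0) v" if v: "v \<in> carrier_vec n" for v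
    proof -
      define w where "w = S j \<tau> *\<^sub>v v"
      have w: "w \<in> carrier_vec n" using pos_def_carrier[OF Sj] v by (simp add: w_def)
      have "Q j \<tau> *\<^sub>v w = v"
        using pos_def_inverse(2)[OF Q[OF j order_refl] v] by (simp add: w_def S_def)
      then have "\<eta> / C * (v \<bullet> v) \<le> \<eta> * (w \<bullet> w)"
        using C(2)[OF j w] C(1) \<eta> by (simp add: field_simps)
      then show ?thesis
        using qform_inverse_antitone[OF Q[OF j order_refl] Q[OF i le0] v jump[OF i j ij]]
        by (simp add: w_def S_def)
    qed
    then show ?thesis
      using lmi_gap_iff[OF pos_def_sym[OF Sj] pos_def_sym[OF Si]] by blast
  qed
  have "lmi_condition N \<tau> n m A B S U (\<eta> / C)"
    unfolding lmi_condition_def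
    using S(1) U strict weak gap \<eta> C(1) by (auto simp: pos_def_sym)
  then show ?thesis by blast
qed

section \<open>From matrix inequalities to feedback gains\<close>

lemma pos_semidef_add_pos_scalar:
  assumes S: "pos_semidef_mat n S" and c: "0 < c"
  shows "pos_def_mat n (S + c \<cdot>\<^sub>m 1\<^sub>m n)"
    and "v \<in> carrier_vec n \<Longrightarrow> qform (S + c \<cdot>\<^sub>m 1\<^sub>m n) v = qform S v + c * (v \<bullet> v)"
proof -
  have sym: "sym_mat n S" using S by (simp add: pos_semidef_qform)
  show form: "qform (S + c \<cdot>\<^sub>m 1\<^sub>m n) v = qform S v + c * (v \<bullet> v)" if v: "v \<in> carrier_vec n" for v
    using sym_mat_carrier[OF sym] by (simp add: qform_mat[OF v])
  have "0 < qform (S + c \<cdot>\<^sub>m 1\<^sub>m n) v" if v: "v \<in> carrier_vec n" "v \<noteq> 0\<^sub>v n" for v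
  proof -
    have "0 \<le> qform S v" using S v by (simp add: pos_semidef_qform)
    then show ?thesis using form[OF v(1)] mult_pos_pos[OF c scalar_prod_self_pos[OF v]] by simp
  qed
  moreover have "sym_mat n (S + c \<cdot>\<^sub>m 1\<^sub>m n)"
    by (rule sym_mat_intros(1)[OF sym sym_mat_intros(3)[OF sym_mat_intros(5)]])
  ultimately show "pos_def_mat n (S + c \<cdot>\<^sub>m 1\<^sub>m n)"
    by (simp add: pos_def_qform)
qed

text \<open>
  As \<open>N \<ge> 2\<close> and \<open>\<tau> \<ge> 1\<close>, the joint quantification over \<open>i \<noteq> j\<close> and \<open>k < \<tau>\<close> is never empty and
  separates into independent conditions. Semidefiniteness of every \<open>S i k\<close> comes from the lower
  right corner of the block inequalities.
\<close>

lemma lmi_condition_forms: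
  assumes N: "N \<ge> 2" and \<tau>: "\<tau> \<ge> 1"
    and A: "\<forall>i \<in> {1..N}. A i \<in> carrier_mat n n"
    and B: "\<forall>i \<in> {1..N}. B i \<in> carrier_mat n (m i)"
    and lmi: "lmi_condition N \<tau> n m A B S U \<epsilon>"
  shows "0 < \<epsilon>"
    and "\<And>i k. i \<in> {1..N} \<Longrightarrow> k \<le> \<tau> \<Longrightarrow> pos_semidef_mat n (S i k)"
    and "\<And>i. i \<in> {1..N} \<Longrightarrow> pos_def_mat n (S i \<tau>)"
    and "\<And>i k. i \<in> {1..N} \<Longrightarrow> k \<le> \<tau> \<Longrightarrow> U i k \<in> carrier_mat (m i) n"
    and "\<And>i k. i \<in> {1..N} \<Longrightarrow> k \<le> \<tau> \<Longrightarrow> A i * S i k + B i * U i k \<in> carrier_mat n n"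
    and "\<And>i. i \<in> {1..N} \<Longrightarrow>
      sym_block (- S i \<tau>) (A i * S i \<tau> + B i * U i \<tau>) (- S i \<tau>) \<prec>\<^bsub>n + n\<^esub> 0\<^sub>m (n + n) (n + n)"
    and "\<And>i k. i \<in> {1..N} \<Longrightarrow> k < \<tau> \<Longrightarrow>
      sym_block (- S i (Suc k)) (A i * S i k + B i * U i k) (- S i k) \<preceq>\<^bsub>n + n\<^esub> 0\<^sub>m (n + n) (n + n)"
    and "\<And>i j v. i \<in> {1..N} \<Longrightarrow> j \<in> {1..N} \<Longrightarrow> i \<noteq> j \<Longrightarrow> v \<in> carrier_vec n \<Longrightarrow>
      qform (S j \<tau>) v + \<epsilon> * (v \<bullet> v) \<le> qform (S i 0) v"
proof -
  note A = bspec[OF A] and B = bspec[OF B]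
  have other: "\<exists>j \<in> {1..N}. i \<noteq> j" for i
    using N by (intro bexI[of _ "if i = 1 then 2 else 1"]) auto
  have sym: "sym_mat n (S i k)" if "i \<in> {1..N}" "k \<le> \<tau>" for i k
    using lmi that by (simp add: lmi_condition_def)
  show "0 < \<epsilon>" and pd: "\<And>i. i \<in> {1..N} \<Longrightarrow> pos_def_mat n (S i \<tau>)"
    and U: "\<And>i k. i \<in> {1..N} \<Longrightarrow> k \<le> \<tau> \<Longrightarrow> U i k \<in> carrier_mat (m i) n"
    using lmi by (auto simp: lmi_condition_def)
  show Y: "A i * S i k + B i * U i k \<in> carrier_mat n n" if "i \<in> {1..N}" "k \<le> \<tau>" for i k
    using A B U sym_mat_carrier[OF sym] that by (meson add_carrier_mat mult_carrier_mat)
  show "sym_block (- S i \<tau>) (A i * S i \<tau> + B i * U i \<tau>) (- S i \<tau>) \<prec>\<^bsub>n + n\<^esub> 0\<^sub>m (n + n) (n + n)"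
    if "i \<in> {1..N}" for i
  proof -
    have "0 \<in> {0..<\<tau>}" using \<tau> by simp
    then show ?thesis using lmi that other[of i] unfolding lmi_condition_def by blast
  qed
  show weak: "sym_block (- S i (Suc k)) (A i * S i k + B i * U i k) (- S i k) \<preceq>\<^bsub>n + n\<^esub> 0\<^sub>m (n + n) (n + n)"
    if "i \<in> {1..N}" "k < \<tau>" for i k
  proof -
    have "k \<in> {0..<\<tau>}" using that by simp
    then show ?thesis using lmi that other[of i] unfolding lmi_condition_def by blast
  qed
  show "pos_semidef_mat n (S i k)" if i: "i \<in> {1..N}" and k: "k \<le> \<tau>" for i k
  proof (cases "k = \<tau>")
    case True
    then show ?thesis using pos_def_pos_semidef[OF pd[OF i]] by simp
  next
    case False
    then have k': "k < \<tau>" "Suc k \<le> \<tau>" using k by auto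
    have "0 \<le> qform (S i k) v" if v: "v \<in> carrier_vec n" for v
    proof -
      have "2 * (0\<^sub>v n \<bullet> ((A i * S i k + B i * U i k) *\<^sub>v v)) \<le> qform (S i (Suc k)) (0\<^sub>v n) + qform (S i k) v"
        using weak[OF i k'(1), unfolded sym_block_le_iff[OF sym[OF i k'(2)] sym[OF i k] Y[OF i k]]]
        by (rule bspec[OF bspec[OF _ zero_carrier_vec] v])
      then show ?thesis
        using v Y[OF i k] sym_mat_carrier[OF sym[OF i k'(2)]] by (simp add: qform_def mult_mat_zero_vec)
    qed
    then show ?thesis using sym[OF i k] by (simp add: pos_semidef_qform)
  qed
  show "qform (S j \<tau>) v + \<epsilon> * (v \<bullet> v) \<le> qform (S i 0) v"
    if "i \<in> {1..N}" "j \<in> {1..N}" "i \<noteq> j" "v \<in> carrier_vec n" for i j v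
  proof -
    have "0 \<in> {0..<\<tau>}" using \<tau> by simp
    then have "S j \<tau> - S i 0 + \<epsilon> \<cdot>\<^sub>m 1\<^sub>m n \<preceq>\<^bsub>n\<^esub> 0\<^sub>m n n"
      using lmi that unfolding lmi_condition_def by blast
    then show ?thesis
      using lmi_gap_iff[OF sym[of j \<tau>] sym[of i 0]] that by simp
  qed
qed

lemma lyapunov_sequence_telescope:
  assumes "\<And>k. k < t \<Longrightarrow> cl_mat A B K i k \<in> carrier_mat n n"
    and "\<And>k v. k < t \<Longrightarrow> v \<in> carrier_vec n \<Longrightarrow>
      qform (Q (Suc k)) (cl_mat A B K i k *\<^sub>v v) \<le> qform (Q k) v"
    and v: "v \<in> carrier_vec n"
  shows "qform (Q t) (Psi n A B K i t *\<^sub>v v) \<le> qform (Q 0) v"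
  using assms(1,2)
proof (induction t)
  case 0
  then show ?case using v by simp
next
  case (Suc t)
  have F: "cl_mat A B K i t \<in> carrier_mat n n" and \<Psi>: "Psi n A B K i t \<in> carrier_mat n n"
    using Suc.prems(1) by (auto intro: Psi_carrier)
  have "Psi n A B K i (Suc t) *\<^sub>v v = cl_mat A B K i t *\<^sub>v (Psi n A B K i t *\<^sub>v v)"
    using F \<Psi> v by simp
  also have "qform (Q (Suc t)) \<dots> \<le> qform (Q t) (Psi n A B K i t *\<^sub>v v)"
    by (rule Suc.prems(2)) (use \<Psi> v in auto)
  also have "\<dots> \<le> qform (Q 0) v"
    using Suc by simp
  finally show ?case .
qed

text \<open>
  With weights \<open>(S i k)\<^sup>-\<^sup>1\<close>, the block inequalities telescope to
  \<open>\<Psi>' (S i \<tau>)\<^sup>-\<^sup>1 \<Psi> \<preceq> (S i 0)\<^sup>-\<^sup>1\<close>, and the gap \<open>\<epsilon>\<close> makes \<open>(S i 0)\<^sup>-\<^sup>1\<close> strictly smaller than \<open>(S j \<tau>)\<^sup>-\<^sup>1\<close>.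
\<close>

lemma invertible_lmi_imp_gain:
  assumes N: "N \<ge> 2" and \<tau>: "\<tau> \<ge> 1"
    and A: "\<forall>i \<in> {1..N}. A i \<in> carrier_mat n n"
    and B: "\<forall>i \<in> {1..N}. B i \<in> carrier_mat n (m i)"
    and lmi: "lmi_condition N \<tau> n m A B S U \<epsilon>" and inv: "all_invertible N \<tau> S"
  shows "gain_condition N \<tau> n m A B (\<lambda>i. minv (S i \<tau>)) (lmi_gain S U)"
proof -
  let ?I = "{1..N}"
  let ?K = "lmi_gain S U"
  let ?F = "cl_mat A B ?K"
  note L = lmi_condition_forms[OF N \<tau> A B lmi]
  note A = bspec[OF A] and B = bspec[OF B]
  have S: "pos_def_mat n (S i k)" if "i \<in> ?I" "k \<le> \<tau>" for i k
    using pos_semidef_invertible_pos_def[OF L(2)[OF that]] inv that by (simp add: all_invertible_def)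
  note Sinv = invertible_mat_inverse[OF pos_def_carrier[OF S] pos_def_invertible[OF S]]
  have K: "?K i k \<in> carrier_mat (m i) n" if "i \<in> ?I" "k \<le> \<tau>" for i k
    using L(4)[OF that] Sinv(1)[OF that that] by (auto simp: lmi_gain_def)
  have F: "?F i k \<in> carrier_mat n n" if "i \<in> ?I" "k \<le> \<tau>" for i k
    by (rule cl_mat_carrier[OF A B K]) (use that in auto)
  have KS: "?K i k * S i k = U i k" if "i \<in> ?I" "k \<le> \<tau>" for i k
    using assoc_mult_mat[OF L(4)[OF that] Sinv(1)[OF that that] pos_def_carrier[OF S[OF that]]]
      Sinv(3)[OF that that] L(4)[OF that] by (simp add: lmi_gain_def)
  have fac: "A i * S i k + B i * U i k = ?F i k * S i k" if "i \<in> ?I" "k \<le> \<tau>" for i k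
    using closed_loop_factor[of A i n B "m i" ?K k "S i k"] A[OF that(1)] B[OF that(1)] K[OF that]
      pos_def_carrier[OF S[OF that]] KS[OF that] by simp
  have dec: "qform (minv (S i (Suc k))) (?F i k *\<^sub>v v) \<le> qform (minv (S i k)) v"
    if i: "i \<in> ?I" and k: "k < \<tau>" and v: "v \<in> carrier_vec n" for i k v
  proof -
    have k': "k \<le> \<tau>" "Suc k \<le> \<tau>" using k by auto
    show ?thesis
      using L(7)[OF i k, unfolded fac[OF i k'(1)] schur_le_iff[OF S[OF i k'(2)] S[OF i k'(1)] F[OF i k'(1)]]] v
      by blast
  qed
  have strict: "qform (minv (S i \<tau>)) (?F i \<tau> *\<^sub>v v) < qform (minv (S i \<tau>)) v"
    if i: "i \<in> ?I" and v: "v \<in> carrier_vec n" "v \<noteq> 0\<^sub>v n" for i v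
    using L(6)[OF i, unfolded fac[OF i order_refl] schur_less_iff[OF S[OF i order_refl] S[OF i order_refl] F[OF i order_refl]]] v
    by blast
  have jump: "qform (minv (S i \<tau>)) (Psi n A B ?K i \<tau> *\<^sub>v v) < qform (minv (S j \<tau>)) v"
    if i: "i \<in> ?I" and j: "j \<in> ?I" and ij: "i \<noteq> j" and v: "v \<in> carrier_vec n" "v \<noteq> 0\<^sub>v n" for i j v
  proof -
    note Si = S[OF i le0] and Sj = S[OF j order_refl]
    let ?w = "minv (S i 0) *\<^sub>v v"
    have "?w \<in> carrier_vec n" using pos_def_carrier[OF pos_def_inverse(1)[OF Si]] v by simp
    moreover have "?w \<noteq> 0\<^sub>v n"
      using pos_def_inverse(2)[OF Si v(1)] v(2) pos_def_carrier[OF Si] by (metis mult_mat_zero_vec)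
    ultimately have pos: "0 < \<epsilon> * (?w \<bullet> ?w)"
      using L(1) scalar_prod_self_pos by simp
    have "qform (minv (S i \<tau>)) (Psi n A B ?K i \<tau> *\<^sub>v v) \<le> qform (minv (S i 0)) v"
      by (rule lyapunov_sequence_telescope[where Q = "\<lambda>k. minv (S i k)"])
        (use F dec i v in auto)
    also have "\<dots> < qform (minv (S i 0)) v + \<epsilon> * (?w \<bullet> ?w)" using pos by simp
    also have "\<dots> \<le> qform (minv (S j \<tau>)) v"
      using qform_inverse_antitone[OF Si Sj v(1) L(8)[OF i j ij]] .
    finally show ?thesis .
  qed
  have \<Psi>: "Psi n A B ?K i \<tau> \<in> carrier_mat n n" if "i \<in> ?I" for i
    using F that by (intro Psi_carrier) auto
  have P: "pos_def_mat n (minv (S i \<tau>))" if "i \<in> ?I" for i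
    by (rule pos_def_inverse(1)[OF S[OF that order_refl]])
  show ?thesis
    unfolding gain_condition_def
    using P K F \<Psi> strict jump
    by (auto intro!: congruence_decreaseI pos_def_sym)
qed

text \<open>
  For \<open>k < \<tau>\<close> the matrix \<open>S i k\<close> is replaced by \<open>S i k + \<eta> c\<^sup>k I\<close> with the same \<open>U i k\<close>. This adds
  \<open>\<eta> c\<^sup>k A i\<close> off the diagonal, and \<open>2 (a \<bullet> A i b) \<le> |A i' a|\<^sup>2 + |b|\<^sup>2 \<le> c |a|\<^sup>2 + |b|\<^sup>2\<close> shows that a growth
  factor \<open>c \<ge> |A i'|\<^sup>2\<close> of the perturbations is enough. At \<open>k = \<tau>\<close> the pair
  \<open>(S i \<tau>, U i \<tau>)\<close> is scaled by \<open>1 + \<theta>\<close> instead, which preserves the strict inequality.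
\<close>

lemma lmi_imp_invertible_lmi:
  assumes N: "N \<ge> 2" and \<tau>: "\<tau> \<ge> 1"
    and A: "\<forall>i \<in> {1..N}. A i \<in> carrier_mat n n"
    and B: "\<forall>i \<in> {1..N}. B i \<in> carrier_mat n (m i)"
    and lmi: "lmi_condition N \<tau> n m A B S U \<epsilon>"
  shows "\<exists>S' U' \<epsilon>'. lmi_condition N \<tau> n m A B S' U' \<epsilon>' \<and> all_invertible N \<tau> S'"
proof -
  let ?I = "{1..N}"
  note L = lmi_condition_forms[OF N \<tau> A B lmi]
  note A = bspec[OF A] and B = bspec[OF B]
  note sym = L(2)[unfolded pos_semidef_qform, THEN conjunct1]
  have evc: "\<forall>\<^sub>F C in at_top. 1 < C \<and> (\<forall>i \<in> ?I. \<forall>v \<in> carrier_vec n.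
      (transpose_mat (A i) *\<^sub>v v) \<bullet> (transpose_mat (A i) *\<^sub>v v) \<le> C * (v \<bullet> v))"
    using A by (intro eventually_conj eventually_gt_at_top eventually_ball_finite ballI
        mat_vec_norm_bounded) auto
  obtain c where c: "1 < c"
    "\<And>i v. i \<in> ?I \<Longrightarrow> v \<in> carrier_vec n \<Longrightarrow>
      (transpose_mat (A i) *\<^sub>v v) \<bullet> (transpose_mat (A i) *\<^sub>v v) \<le> c * (v \<bullet> v)"
    using eventually_happens'[OF trivial_limit_at_top_linorder evc] by auto
  have evM: "\<forall>\<^sub>F C in at_top. 0 < C \<and> (\<forall>i \<in> ?I. \<forall>v \<in> carrier_vec n. qform (S i \<tau>) v \<le> C * (v \<bullet> v))"
    using pos_def_carrier[OF L(3)] by (intro eventually_conj eventually_gt_at_top eventually_ball_finite ballI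
        qform_bounded) auto
  obtain M where M: "0 < M" "\<And>i v. i \<in> ?I \<Longrightarrow> v \<in> carrier_vec n \<Longrightarrow> qform (S i \<tau>) v \<le> M * (v \<bullet> v)"
    using eventually_happens'[OF trivial_limit_at_top_linorder evM] by auto
  have evs: "\<forall>\<^sub>F s in at_right 0. 0 < s \<and> (\<forall>i \<in> ?I. \<forall>v \<in> carrier_vec n. s * (v \<bullet> v) \<le> qform (S i \<tau>) v)"
    using pos_def_coercive[OF L(3)] by (intro eventually_conj eventually_at_right_less
        eventually_ball_finite[of ?I]) auto
  obtain s where s: "0 < s" "\<And>i v. i \<in> ?I \<Longrightarrow> v \<in> carrier_vec n \<Longrightarrow> s * (v \<bullet> v) \<le> qform (S i \<tau>) v"
    using eventually_happens'[OF trivial_limit_at_right_real evs] by auto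
  \<comment> \<open>\<open>\<theta> M = \<epsilon> / 2\<close>: the scaling costs at most half of the gap\<close>
  define \<theta> where "\<theta> = \<epsilon> / (2 * M)"
  \<comment> \<open>\<open>\<eta> c\<^sup>\<tau> = \<theta> s\<close>: the scaling adds at least the perturbation due at \<open>\<tau>\<close>\<close>
  define \<eta> where "\<eta> = \<theta> * s / c ^ \<tau>"
  define S' where "S' i k = (if k = \<tau> then (1 + \<theta>) \<cdot>\<^sub>m S i \<tau> else S i k + (\<eta> * c ^ k) \<cdot>\<^sub>m 1\<^sub>m n)" for i k
  define U' where "U' i k = (if k = \<tau> then (1 + \<theta>) \<cdot>\<^sub>m U i \<tau> else U i k)" for i k
  have \<theta>: "0 < \<theta>" using L(1) M(1) by (simp add: \<theta>_def)
  have \<eta>: "0 < \<eta>" and \<eta>c: "0 < \<eta> * c ^ k" for k using \<theta> s(1) c(1) by (simp_all add: \<eta>_def)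
  have form_\<tau>: "qform (S' i \<tau>) v = (1 + \<theta>) * qform (S i \<tau>) v" if "i \<in> ?I" "v \<in> carrier_vec n" for i v
    using qform_mat(3)[OF that(2) pos_def_carrier[OF L(3)[OF that(1)]]] by (simp add: S'_def)
  have form_k: "qform (S' i k) v = qform (S i k) v + \<eta> * c ^ k * (v \<bullet> v)"
    if "i \<in> ?I" "k < \<tau>" "v \<in> carrier_vec n" for i k v
    using pos_semidef_add_pos_scalar(2)[OF L(2) \<eta>c] that by (simp add: S'_def)
  have form_ge: "qform (S i k) v + \<eta> * c ^ k * (v \<bullet> v) \<le> qform (S' i k) v"
    if "i \<in> ?I" "k \<le> \<tau>" "v \<in> carrier_vec n" for i k v
  proof (cases "k = \<tau>")
    case True
    have "\<eta> * c ^ \<tau> * (v \<bullet> v) = \<theta> * (s * (v \<bullet> v))" using c(1) by (simp add: \<eta>_def)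
    also have "\<dots> \<le> \<theta> * qform (S i \<tau>) v" using s(2) that \<theta> by (intro mult_left_mono) auto
    finally show ?thesis using form_\<tau> that True by (simp add: algebra_simps)
  next
    case False
    then show ?thesis using form_k that by simp
  qed
  have pd: "pos_def_mat n (S' i k)" if i: "i \<in> ?I" and k: "k \<le> \<tau>" for i k
  proof (cases "k = \<tau>")
    case True
    have "sym_mat n (S' i \<tau>)" using sym_mat_intros(3)[OF pos_def_sym[OF L(3)[OF i]]] by (simp add: S'_def)
    moreover have "0 < qform (S' i \<tau>) v" if "v \<in> carrier_vec n" "v \<noteq> 0\<^sub>v n" for v
      using form_\<tau>[OF i that(1)] L(3)[OF i] \<theta> that by (simp add: pos_def_qform)
    ultimately show ?thesis using True by (simp add: pos_def_qform)
  next
    case False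
    then show ?thesis using pos_semidef_add_pos_scalar(1)[OF L(2)[OF i k] \<eta>c] by (simp add: S'_def)
  qed
  have U'c: "U' i k \<in> carrier_mat (m i) n" if "i \<in> ?I" "k \<le> \<tau>" for i k
    using L(4)[OF that] L(4)[OF that(1) order_refl] by (simp add: U'_def)
  have Y'c: "A i * S' i k + B i * U' i k \<in> carrier_mat n n" if "i \<in> ?I" "k \<le> \<tau>" for i k
    using A B U'c pos_def_carrier[OF pd] that by (meson add_carrier_mat mult_carrier_mat)
  have strict: "sym_block (- S' i \<tau>) (A i * S' i \<tau> + B i * U' i \<tau>) (- S' i \<tau>) \<prec>\<^bsub>n + n\<^esub> 0\<^sub>m (n + n) (n + n)"
    if i: "i \<in> ?I" for i
  proof -
    let ?Y = "A i * S i \<tau> + B i * U i \<tau>"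
    note Y = L(5)[OF i order_refl]
    have "A i * S' i \<tau> + B i * U' i \<tau> = (1 + \<theta>) \<cdot>\<^sub>m ?Y"
      using A[OF i] B[OF i] L(4)[OF i order_refl] pos_def_carrier[OF L(3)[OF i]]
      by (simp add: S'_def U'_def mult_smult_distrib[of _ n n] mult_smult_distrib[of _ n "m i"]
          add_smult_distrib_left_mat[of _ n n])
    then have "a \<bullet> ((A i * S' i \<tau> + B i * U' i \<tau>) *\<^sub>v b) = (1 + \<theta>) * (a \<bullet> (?Y *\<^sub>v b))"
      if "a \<in> carrier_vec n" "b \<in> carrier_vec n" for a b
      using that Y by (auto simp: scalar_prod_def sum_distrib_left ac_simps intro!: sum.cong)
    then show ?thesis
      unfolding sym_block_less_iff[OF pos_def_sym[OF pd[OF i order_refl]] pos_def_sym[OF pd[OF i order_refl]] Y'c[OF i order_refl]]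
      using L(6)[OF i, unfolded sym_block_less_iff[OF pos_def_sym[OF L(3)[OF i]] pos_def_sym[OF L(3)[OF i]] Y]] \<theta>
      by (simp add: form_\<tau>[OF i] mult.left_commute[of 2] flip: distrib_left)
  qed
  have weak: "sym_block (- S' i (Suc k)) (A i * S' i k + B i * U' i k) (- S' i k) \<preceq>\<^bsub>n + n\<^esub> 0\<^sub>m (n + n) (n + n)"
    if i: "i \<in> ?I" and k: "k < \<tau>" for i k
  proof -
    have k': "k \<le> \<tau>" "Suc k \<le> \<tau>" using k by auto
    let ?Y = "A i * S i k + B i * U i k"
    let ?\<mu> = "\<eta> * c ^ k"
    note Y = L(5)[OF i k'(1)]
    have Sc: "S i k \<in> carrier_mat n n" by (rule sym_mat_carrier[OF sym[OF i k'(1)]])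
    have AT: "transpose_mat (A i) \<in> carrier_mat n n" using A[OF i] by simp
    have "2 * (a \<bullet> ((A i * S' i k + B i * U' i k) *\<^sub>v b)) \<le> qform (S' i (Suc k)) a + qform (S' i k) b"
      if a: "a \<in> carrier_vec n" and b: "b \<in> carrier_vec n" for a b
    proof -
      have "(A i * S' i k + B i * U' i k) *\<^sub>v b = ?Y *\<^sub>v b + ?\<mu> \<cdot>\<^sub>v (A i *\<^sub>v b)"
      proof -
        have "S' i k = S i k + ?\<mu> \<cdot>\<^sub>m 1\<^sub>m n" "U' i k = U i k" using k by (auto simp: S'_def U'_def)
        then have "A i * S' i k + B i * U' i k = A i * S i k + ?\<mu> \<cdot>\<^sub>m A i + B i * U i k"
          using A[OF i] Sc mult_add_distrib_mat[OF A[OF i] Sc, of "?\<mu> \<cdot>\<^sub>m 1\<^sub>m n"]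
            mult_smult_distrib[OF A[OF i] one_carrier_mat, of ?\<mu>] by simp
        also have "\<dots> = ?Y + ?\<mu> \<cdot>\<^sub>m A i"
          using A[OF i] B[OF i] Sc L(4)[OF i k'(1)] by (intro eq_matI) auto
        finally show ?thesis
          using A[OF i] b Y add_mult_distrib_mat_vec[OF Y _ b, of "?\<mu> \<cdot>\<^sub>m A i"]
          by (auto intro!: eq_vecI)
      qed
      then have "a \<bullet> ((A i * S' i k + B i * U' i k) *\<^sub>v b) = a \<bullet> (?Y *\<^sub>v b) + ?\<mu> * (a \<bullet> (A i *\<^sub>v b))"
        using a b Y A[OF i] by (simp add: scalar_prod_add_distrib[of _ n] scalar_prod_smult_distrib[of _ n])
      moreover have "2 * (a \<bullet> (?Y *\<^sub>v b)) \<le> qform (S i (Suc k)) a + qform (S i k) b"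
        using L(7)[OF i k, unfolded sym_block_le_iff[OF sym[OF i k'(2)] sym[OF i k'(1)] Y]] a b by blast
      moreover have "2 * (a \<bullet> (A i *\<^sub>v b)) \<le> c * (a \<bullet> a) + b \<bullet> b"
      proof -
        let ?a = "transpose_mat (A i) *\<^sub>v a"
        have ac: "?a \<in> carrier_vec n" using AT a by simp
        have "0 \<le> qform (1\<^sub>m n) (?a - b)" using ac b by (simp add: qform_mat[of _ n] scalar_prod_self_nonneg)
        also have "\<dots> = ?a \<bullet> ?a - 2 * (?a \<bullet> b) + b \<bullet> b"
          using qform_diff_vec[OF sym_mat_intros(5) ac b] ac b by (simp add: qform_mat[of _ n])
        also have "?a \<bullet> b = a \<bullet> (A i *\<^sub>v b)" by (rule transpose_vec_mult_scalar[OF A[OF i] b a])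
        finally show ?thesis using c(2)[OF i a] by simp
      qed
      then have "2 * (?\<mu> * (a \<bullet> (A i *\<^sub>v b))) \<le> \<eta> * c ^ Suc k * (a \<bullet> a) + ?\<mu> * (b \<bullet> b)"
        using mult_left_mono[of "2 * (a \<bullet> (A i *\<^sub>v b))" "c * (a \<bullet> a) + b \<bullet> b" ?\<mu>] \<eta>c[of k]
        by (simp add: algebra_simps)
      ultimately show ?thesis
        using form_ge[OF i k'(2) a] form_ge[OF i k'(1) b] by simp
    qed
    then show ?thesis
      by (simp add: sym_block_le_iff[OF pos_def_sym[OF pd[OF i k'(2)]] pos_def_sym[OF pd[OF i k'(1)]] Y'c[OF i k'(1)]])
  qed
  have gap: "S' j \<tau> - S' i 0 + (\<epsilon> / 2) \<cdot>\<^sub>m 1\<^sub>m n \<preceq>\<^bsub>n\<^esub> 0\<^sub>m n n"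
    if i: "i \<in> ?I" and j: "j \<in> ?I" and ij: "i \<noteq> j" for i j
  proof (subst lmi_gap_iff[OF pos_def_sym[OF pd[OF j order_refl]] pos_def_sym[OF pd[OF i le0]]], intro ballI)
    fix v :: "real vec" assume v: "v \<in> carrier_vec n"
    have "\<theta> * qform (S j \<tau>) v \<le> \<theta> * (M * (v \<bullet> v))"
      using M(2)[OF j v] \<theta> by (intro mult_left_mono) auto
    also have "\<dots> = \<epsilon> / 2 * (v \<bullet> v)" using M(1) by (simp add: \<theta>_def)
    finally have "qform (S' j \<tau>) v + \<epsilon> / 2 * (v \<bullet> v) \<le> qform (S i 0) v"
      using form_\<tau>[OF j v] L(8)[OF i j ij v] by (simp add: algebra_simps)
    also have "\<dots> \<le> qform (S' i 0) v"
      using form_ge[OF i le0 v] mult_nonneg_nonneg[OF less_imp_le[OF \<eta>] scalar_prod_self_nonneg[of v]]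
      by simp
    finally show "qform (S' j \<tau>) v + \<epsilon> / 2 * (v \<bullet> v) \<le> qform (S' i 0) v" .
  qed
  have "lmi_condition N \<tau> n m A B S' U' (\<epsilon> / 2)"
    unfolding lmi_condition_def
    using pd U'c strict weak gap L(1) by (auto simp: pos_def_sym)
  moreover have "all_invertible N \<tau> S'"
    using pos_def_invertible[OF pd] by (simp add: all_invertible_def)
  ultimately show ?thesis by blast
qed

section \<open>Stability of the closed loop\<close>

text \<open>
  The time since the last switch, read off from the signal alone; \<open>phase_eq\<close> relates it to the
  sequence of switching instants.
\<close>

primrec phase :: "(nat \<Rightarrow> nat) \<Rightarrow> nat \<Rightarrow> nat" where
  "phase \<sigma> 0 = 0"
| "phase \<sigma> (Suc t) = (if \<sigma> (Suc t) = \<sigma> t then Suc (phase \<sigma> t) else 0)"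

context
  fixes N \<tau> :: nat and \<sigma> :: "nat \<Rightarrow> nat" and \<phi> :: "nat \<Rightarrow> enat"
  assumes switching: "switching_signal N \<sigma> \<phi>"
begin

lemma switching_instants:
  shows "\<sigma> t \<in> {1..N}"
    and "\<phi> 0 = enat 0"
    and "\<phi> q = \<infinity> \<Longrightarrow> \<phi> (Suc q) = \<infinity>"
    and "\<phi> q = enat s \<Longrightarrow> enat s < \<phi> (Suc q)"
    and "\<phi> q = enat s \<Longrightarrow> s \<le> t \<Longrightarrow> enat t < \<phi> (Suc q) \<Longrightarrow> \<sigma> t = \<sigma> s"
    and "\<phi> q = enat s \<Longrightarrow> \<phi> (Suc q) = enat s' \<Longrightarrow> \<sigma> s' \<noteq> \<sigma> s"
  using switching unfolding switching_signal_def
  by (metis enat_0 enat.distinct(2))+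

lemma switching_interval:
  obtains q s where "\<phi> q = enat s" and "s \<le> t" and "enat t < \<phi> (Suc q)"
proof -
  have "\<exists>q s. \<phi> q = enat s \<and> s \<le> t \<and> enat t < \<phi> (Suc q)"
  proof (induction t)
    case 0
    then show ?case using switching_instants(2,4) by blast
  next
    case (Suc t)
    then obtain q s where q: "\<phi> q = enat s" "s \<le> t" "enat t < \<phi> (Suc q)" by blast
    show ?case
    proof (cases "enat (Suc t) < \<phi> (Suc q)")
      case True
      then show ?thesis using q le_SucI by blast
    next
      case False
      then have "\<phi> (Suc q) = enat (Suc t)"
        using q(3) by (cases "\<phi> (Suc q)") auto
      then show ?thesis using switching_instants(4) by blast
    qed
  qed
  then show thesis using that by blast
qed

lemma phase_switching_instant:
  assumes "\<phi> q = enat s"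
  shows "phase \<sigma> s = 0"
proof (cases q)
  case 0
  then show ?thesis using assms switching_instants(2) by simp
next
  case (Suc p)
  then obtain s' where s': "\<phi> p = enat s'"
    using assms switching_instants(3) by (cases "\<phi> p") auto
  have "s' < s" using switching_instants(4)[OF s'] assms Suc by simp
  then obtain r where r: "s = Suc r" "s' \<le> r" by (cases s) auto
  have "\<sigma> r = \<sigma> s'" using switching_instants(5)[OF s' r(2)] assms Suc r(1) by simp
  moreover have "\<sigma> s \<noteq> \<sigma> s'" using switching_instants(6)[OF s'] assms Suc by simp
  ultimately show ?thesis by (simp add: r(1))
qed

lemma phase_eq:
  assumes q: "\<phi> q = enat s" and "enat (s + k) < \<phi> (Suc q)"
  shows "phase \<sigma> (s + k) = k"
  using assms(2)
proof (induction k)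
  case 0
  then show ?case using phase_switching_instant[OF q] by simp
next
  case (Suc k)
  have less: "enat (s + k) < \<phi> (Suc q)"
    by (rule le_less_trans[OF _ Suc.prems]) simp
  have "\<sigma> (s + k) = \<sigma> s" "\<sigma> (s + Suc k) = \<sigma> s"
    using switching_instants(5)[OF q] less Suc.prems by auto
  then show ?case using Suc.IH[OF less] by simp
qed

lemma dwell_time_greater:
  assumes "\<phi> q = enat s" and "enat (s + k) < \<phi> (Suc q)"
  shows "enat k < dwell_time \<phi> q"
  using assms by (cases "\<phi> (Suc q)") (auto simp: dwell_time_def)

text \<open>
  The instant \<open>t\<close> is the last one of its dwell period, so \<open>Suc (phase \<sigma> t)\<close> is the dwell-time.
\<close>

lemma phase_before_switch:
  assumes dwell: "\<forall>q. dwell_time \<phi> q \<ge> enat \<tau>" and switch: "\<sigma> (Suc t) \<noteq> \<sigma> t"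
  shows "\<tau> \<le> Suc (phase \<sigma> t)"
proof -
  obtain q s where q: "\<phi> q = enat s" "s \<le> t" "enat t < \<phi> (Suc q)"
    by (rule switching_interval)
  have "\<sigma> t = \<sigma> s" using switching_instants(5)[OF q] .
  then have "\<not> enat (Suc t) < \<phi> (Suc q)"
    using switching_instants(5)[OF q(1), of "Suc t"] q(2) switch by auto
  then have "\<phi> (Suc q) = enat (Suc t)"
    using q(3) by (cases "\<phi> (Suc q)") auto
  then have "\<tau> \<le> Suc t - s"
    using spec[OF dwell, of q] q(1) by (simp add: dwell_time_def)
  moreover have "phase \<sigma> t = t - s"
    using phase_eq[OF q(1), of "t - s"] q by simp
  ultimately show ?thesis using q(2) by simp
qed

lemma closed_loop_step:
  assumes A: "\<forall>i \<in> {1..N}. A i \<in> carrier_mat n n"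
    and B: "\<forall>i \<in> {1..N}. B i \<in> carrier_mat n (m i)"
    and K: "\<forall>i \<in> {1..N}. \<forall>k \<le> \<tau>. K i k \<in> carrier_mat (m i) n"
    and traj: "closed_loop \<tau> n m A B K \<sigma> \<phi> t0 x" and t: "t0 \<le> t"
  shows "x (Suc t) = cl_mat A B K (\<sigma> t) (min (phase \<sigma> t) \<tau>) *\<^sub>v x t"
proof -
  let ?k = "min (phase \<sigma> t) \<tau>"
  obtain u where x: "x t \<in> carrier_vec n"
    and step: "x (Suc t) = A (\<sigma> t) *\<^sub>v x t + B (\<sigma> t) *\<^sub>v u (\<sigma> t) t"
    and fb: "state_feedback \<tau> K \<sigma> \<phi> t0 x u"
    using traj t by (auto simp: closed_loop_def)
  obtain q s where q: "\<phi> q = enat s" "s \<le> t" "enat t < \<phi> (Suc q)"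
    by (rule switching_interval)
  have \<sigma>: "\<sigma> t = \<sigma> s" using switching_instants(5)[OF q] .
  define k where "k = t - s"
  have tk: "t = s + k" using q(2) by (simp add: k_def)
  have "enat k < dwell_time \<phi> q" "phase \<sigma> t = k"
    using dwell_time_greater[OF q(1)] phase_eq[OF q(1)] q(3) by (auto simp: tk)
  then have u: "u (\<sigma> t) t = K (\<sigma> t) ?k *\<^sub>v x t"
    using fb q(1) t unfolding \<sigma> state_feedback_def by (auto simp: tk)
  have i: "\<sigma> t \<in> {1..N}" by (rule switching_instants(1))
  have "cl_mat A B K (\<sigma> t) ?k *\<^sub>v x t = A (\<sigma> t) *\<^sub>v x t + B (\<sigma> t) * K (\<sigma> t) ?k *\<^sub>v x t"
    unfolding cl_mat_def
    by (rule add_mult_distrib_mat_vec[of _ n n]) (use A B K i x in \<open>auto intro!: mult_carrier_mat[of _ n "m (\<sigma> t)"]\<close>)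
  also have "B (\<sigma> t) * K (\<sigma> t) ?k *\<^sub>v x t = B (\<sigma> t) *\<^sub>v (K (\<sigma> t) ?k *\<^sub>v x t)"
    by (rule assoc_mult_mat_vec[OF bspec[OF B i] K[rule_format, OF i] x]) simp
  finally show ?thesis using step u by simp
qed

end

text \<open>
  \<open>V\<close> decreases to a limit, so its decrements, which dominate \<open>\<eta> w\<close>, tend to zero.
\<close>

lemma dissipation_imp_tendsto_zero:
  fixes V w :: "nat \<Rightarrow> real"
  assumes \<eta>: "0 < \<eta>" and V: "\<And>t. 0 \<le> V t" and w: "\<And>t. 0 \<le> w t"
    and dec: "\<And>t. V (Suc t) + \<eta> * w t \<le> V t"
  shows "w \<longlonglongrightarrow> 0"
proof -
  have "V (Suc t) \<le> V t" for t
    using dec[of t] mult_nonneg_nonneg[OF less_imp_le[OF \<eta>] w[of t]] by simp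
  then have "decseq V" by (rule decseq_SucI)
  then obtain L where L: "V \<longlonglongrightarrow> L"
    using V decseq_convergent by blast
  have "(\<lambda>t. (V t - V (Suc t)) / \<eta>) \<longlonglongrightarrow> (L - L) / \<eta>"
    by (intro tendsto_intros L LIMSEQ_Suc[OF L]) (use \<eta> in simp)
  then have "(\<lambda>t. (V t - V (Suc t)) / \<eta>) \<longlonglongrightarrow> 0" by simp
  then show ?thesis
  proof (rule tendsto_sandwich[OF _ _ tendsto_const, rotated 2])
    have "w t \<le> (V t - V (Suc t)) / \<eta>" for t
      using dec[of t] \<eta> by (simp add: field_simps)
    then show "\<forall>\<^sub>F t in sequentially. w t \<le> (V t - V (Suc t)) / \<eta>" by simp
  qed (use w in simp)
qed

text \<open>
  Within a mode the Lyapunov function \<open>V\<close> follows the certificate. At a switch the dwell-time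
  condition guarantees that the old mode has reached the final weight \<open>Q j \<tau>\<close>, above which the initial
  weight of the new mode never lies, so \<open>V\<close> keeps decreasing.
\<close>

lemma certificate_imp_stabilizing:
  assumes A: "\<forall>i \<in> {1..N}. A i \<in> carrier_mat n n"
    and B: "\<forall>i \<in> {1..N}. B i \<in> carrier_mat n (m i)"
    and K: "\<forall>i \<in> {1..N}. \<forall>k \<le> \<tau>. K i k \<in> carrier_mat (m i) n"
    and cert: "lyapunov_certificate N \<tau> n (cl_mat A B K) Q \<eta>"
  shows "stabilizing N \<tau> n m A B K"
  unfolding stabilizing_def
proof (intro allI impI)
  fix \<sigma> \<phi>
  assume "switching_signal N \<sigma> \<phi> \<and> (\<forall>q. dwell_time \<phi> q \<ge> enat \<tau>)"
  then have sw: "switching_signal N \<sigma> \<phi>" and dwell: "\<forall>q. dwell_time \<phi> q \<ge> enat \<tau>" by auto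
  let ?I = "{1..N}"
  let ?F = "cl_mat A B K"
  let ?traj = "closed_loop \<tau> n m A B K \<sigma> \<phi>"
  have \<eta>: "0 < \<eta>"
    and Q: "\<And>i k. i \<in> ?I \<Longrightarrow> k \<le> \<tau> \<Longrightarrow> pos_def_mat n (Q i k)"
    and dec: "\<And>i k v. i \<in> ?I \<Longrightarrow> k \<le> \<tau> \<Longrightarrow> v \<in> carrier_vec n \<Longrightarrow>
        qform (Q i (min (Suc k) \<tau>)) (?F i k *\<^sub>v v) + \<eta> * (v \<bullet> v) \<le> qform (Q i k) v"
    and jump: "\<And>i j v. i \<in> ?I \<Longrightarrow> j \<in> ?I \<Longrightarrow> i \<noteq> j \<Longrightarrow> v \<in> carrier_vec n \<Longrightarrow>
        qform (Q i 0) v + \<eta> * (v \<bullet> v) \<le> qform (Q j \<tau>) v"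
    using cert by (auto simp: lyapunov_certificate_def)
  have \<sigma>: "\<sigma> t \<in> ?I" for t by (rule switching_instants(1)[OF sw])
  have eva: "\<forall>\<^sub>F a in at_right (0 :: real). 0 < a \<and>
      (\<forall>i \<in> ?I. \<forall>k \<in> {..\<tau>}. \<forall>v \<in> carrier_vec n. a * (v \<bullet> v) \<le> qform (Q i k) v)"
    using pos_def_coercive[OF Q]
    by (intro eventually_conj eventually_at_right_less eventually_ball_finite[of ?I]
        eventually_ball_finite[of "{..\<tau>}"] ballI) auto
  obtain a where a: "0 < a"
    "\<And>i k v. i \<in> ?I \<Longrightarrow> k \<le> \<tau> \<Longrightarrow> v \<in> carrier_vec n \<Longrightarrow> a * (v \<bullet> v) \<le> qform (Q i k) v"
    using eventually_happens'[OF trivial_limit_at_right_real eva] by auto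
  have evb: "\<forall>\<^sub>F b in at_top. 0 < b \<and>
      (\<forall>i \<in> ?I. \<forall>k \<in> {..\<tau>}. \<forall>v \<in> carrier_vec n. qform (Q i k) v \<le> b * (v \<bullet> v))"
    using qform_bounded[OF pos_def_carrier[OF Q]]
    by (intro eventually_conj eventually_gt_at_top eventually_ball_finite[of ?I]
        eventually_ball_finite[of "{..\<tau>}"] ballI) auto
  obtain b where b: "0 < b"
    "\<And>i k v. i \<in> ?I \<Longrightarrow> k \<le> \<tau> \<Longrightarrow> v \<in> carrier_vec n \<Longrightarrow> qform (Q i k) v \<le> b * (v \<bullet> v)"
    using eventually_happens'[OF trivial_limit_at_top_linorder evb] by auto
  define V where "V x t = qform (Q (\<sigma> t) (min (phase \<sigma> t) \<tau>)) (x t)" for x t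
  have carrier: "x t \<in> carrier_vec n" if "?traj t0 x" "t0 \<le> t" for t0 t x
    using that by (auto simp: closed_loop_def)
  have V_lower: "a * (x t \<bullet> x t) \<le> V x t" and V_upper: "V x t \<le> b * (x t \<bullet> x t)"
    if "?traj t0 x" "t0 \<le> t" for t0 t x
    using a(2)[OF \<sigma>] b(2)[OF \<sigma>] carrier[OF that] by (auto simp: V_def)
  have V_step: "V x (Suc t) + \<eta> * (x t \<bullet> x t) \<le> V x t" if traj: "?traj t0 x" and t: "t0 \<le> t" for t0 t x
  proof -
    let ?i = "\<sigma> t" and ?k = "min (phase \<sigma> t) \<tau>"
    have xt: "x t \<in> carrier_vec n" and xSt: "x (Suc t) \<in> carrier_vec n"
      using carrier[OF traj] t by auto
    have "x (Suc t) = ?F ?i ?k *\<^sub>v x t" by (rule closed_loop_step[OF sw A B K traj t])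
    then have decr: "qform (Q ?i (min (Suc ?k) \<tau>)) (x (Suc t)) + \<eta> * (x t \<bullet> x t) \<le> V x t"
      using dec[OF \<sigma> _ xt, of ?k t] by (simp add: V_def)
    show ?thesis
    proof (cases "\<sigma> (Suc t) = \<sigma> t")
      case True
      have "min (Suc ?k) \<tau> = min (Suc (phase \<sigma> t)) \<tau>" by simp
      then show ?thesis using decr True by (simp add: V_def)
    next
      case False
      have "min (Suc ?k) \<tau> = \<tau>"
        using phase_before_switch[OF sw dwell False] by simp
      moreover have "0 \<le> \<eta> * (x (Suc t) \<bullet> x (Suc t))"
        using \<eta> scalar_prod_self_nonneg[of "x (Suc t)"] by simp
      ultimately show ?thesis
        using decr jump[OF \<sigma> \<sigma> False xSt] False by (simp add: V_def)
    qed
  qed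
  have V_mono: "V x t \<le> V x t0" if traj: "?traj t0 x" and t: "t0 \<le> t" for t0 t x
    using t
  proof (induction t rule: dec_induct)
    case (step t)
    have "0 \<le> \<eta> * (x t \<bullet> x t)" using \<eta> scalar_prod_self_nonneg[of "x t"] by simp
    then show ?case using V_step[OF traj step(1)] step(3) by simp
  qed simp
  show "asymptotically_stable ?traj"
    unfolding asymptotically_stable_def
  proof (intro allI conjI impI)
    fix t0 and e :: real
    assume e: "0 < e"
    \<comment> \<open>\<open>b d\<^sup>2 = a e\<^sup>2\<close> for the bounds \<open>a |v|\<^sup>2 \<le> qform (Q i k) v \<le> b |v|\<^sup>2\<close>\<close>
    define d where "d = e * sqrt (a / b)"
    have d: "0 < d" "d\<^sup>2 = e\<^sup>2 * a / b" using e a(1) b(1) by (simp_all add: d_def power_mult_distrib)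
    have "vec_nrm (x t) < e" if traj: "?traj t0 x" and small: "vec_nrm (x t0) < d" and t: "t0 \<le> t" for x t
    proof -
      have "a * (x t \<bullet> x t) \<le> V x t" by (rule V_lower[OF traj t])
      also have "\<dots> \<le> V x t0" by (rule V_mono[OF traj t])
      also have "\<dots> \<le> b * (x t0 \<bullet> x t0)" by (rule V_upper[OF traj order_refl])
      also have "x t0 \<bullet> x t0 = (vec_nrm (x t0))\<^sup>2"
        by (simp add: vec_nrm_def scalar_prod_self_nonneg)
      also have "b * (vec_nrm (x t0))\<^sup>2 < b * d\<^sup>2"
        by (intro mult_strict_left_mono[OF _ b(1)] power_strict_mono[OF small])
          (simp_all add: vec_nrm_def scalar_prod_self_nonneg)
      also have "\<dots> = a * e\<^sup>2" using b(1) by (simp add: d(2))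
      finally have "x t \<bullet> x t < e\<^sup>2" using a(1) by simp
      then show ?thesis unfolding vec_nrm_def using e by (simp add: real_less_lsqrt)
    qed
    then show "\<exists>d > 0. \<forall>x. ?traj t0 x \<and> vec_nrm (x t0) < d \<longrightarrow> (\<forall>t \<ge> t0. vec_nrm (x t) < e)"
      using d(1) by blast
  next
    fix t0 x
    assume traj: "?traj t0 x"
    have "(\<lambda>t. x (t + t0) \<bullet> x (t + t0)) \<longlonglongrightarrow> 0"
    proof (rule dissipation_imp_tendsto_zero[OF \<eta>, where V = "\<lambda>t. V x (t + t0)"])
      fix t
      show "0 \<le> V x (t + t0)"
        using V_lower[OF traj, of "t + t0"]
          mult_nonneg_nonneg[OF less_imp_le[OF a(1)] scalar_prod_self_nonneg[of "x (t + t0)"]] by simp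
      show "V x (Suc t + t0) + \<eta> * (x (t + t0) \<bullet> x (t + t0)) \<le> V x (t + t0)"
        using V_step[OF traj, of "t + t0"] by simp
    qed (rule scalar_prod_self_nonneg)
    then have "(\<lambda>t. sqrt (x (t + t0) \<bullet> x (t + t0))) \<longlonglongrightarrow> sqrt 0"
      by (rule tendsto_real_sqrt)
    then have "(\<lambda>t. vec_nrm (x (t + t0))) \<longlonglongrightarrow> 0" by (simp add: vec_nrm_def)
    then show "(\<lambda>t. vec_nrm (x t)) \<longlonglongrightarrow> 0" by (rule LIMSEQ_offset)
  qed
qed

section \<open>Equivalence of the two conditions\<close>

theorem theorem5p1:
  fixes N \<tau> n :: nat and m :: "nat \<Rightarrow> nat" and A B :: "nat \<Rightarrow> real mat"
  assumes "N \<ge> 2" and "\<tau> \<ge> 1"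
    and "\<forall>i \<in> {1..N}. A i \<in> carrier_mat n n"
    and "\<forall>i \<in> {1..N}. B i \<in> carrier_mat n (m i)"
  shows "((\<exists>P K. gain_condition N \<tau> n m A B P K) \<longleftrightarrow> (\<exists>S U \<epsilon>. lmi_condition N \<tau> n m A B S U \<epsilon>)) \<and>
         (\<forall>P K. gain_condition N \<tau> n m A B P K \<longrightarrow> stabilizing N \<tau> n m A B K) \<and>
         ((\<exists>S U \<epsilon>. lmi_condition N \<tau> n m A B S U \<epsilon>) \<longrightarrow>
            (\<exists>S U \<epsilon>. lmi_condition N \<tau> n m A B S U \<epsilon> \<and> all_invertible N \<tau> S)) \<and>
         (\<forall>S U \<epsilon>. lmi_condition N \<tau> n m A B S U \<epsilon> \<and> all_invertible N \<tau> S \<longrightarrow>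
            stabilizing N \<tau> n m A B (lmi_gain S U))"
proof -
  have K: "\<forall>i \<in> {1..N}. \<forall>k \<le> \<tau>. K i k \<in> carrier_mat (m i) n"
    if "gain_condition N \<tau> n m A B P K" for P K
    using that by (simp add: gain_condition_def)
  have stab: "stabilizing N \<tau> n m A B K" if gain: "gain_condition N \<tau> n m A B P K" for P K
    using gain_imp_certificate[OF assms(1,3,4) gain]
      certificate_imp_stabilizing[OF assms(3,4) K[OF gain]] by blast
  have lmi: "\<exists>S U \<epsilon>. lmi_condition N \<tau> n m A B S U \<epsilon>"
    if gain: "gain_condition N \<tau> n m A B P K" for P K
    using gain_imp_certificate[OF assms(1,3,4) gain]
      certificate_imp_lmi[OF assms(2-4) K[OF gain]] by blast
  note inv = lmi_imp_invertible_lmi[OF assms]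
  note gain = invertible_lmi_imp_gain[OF assms]
  show ?thesis
    using stab lmi inv gain by blast
qed

end
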